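(* Let $\psi\in\mathcal F^2(\mathcal H_n)$, $\psi\neq 0$. Then there exist an inner function $\varphi\in F^\infty$ and an outer function $g\in\mathcal F^2(\mathcal H_n)$ such that $\psi=\varphi\otimes g$. Moreover, the factorization is essentially unique: if $\psi=\varphi_1\otimes g_1=\varphi_2\otimes g_2$ with $\varphi_1,\varphi_2$ inner and $g_1,g_2$ outer, then there is $\alpha\in\mathbb C$ with $|\alpha|=1$ such that $\varphi_1=\alpha\varphi_2$ and $g_2=\alpha g_1$. Furthermore, $\psi\in F^\infty$ if and only if $g\in F^\infty$, and in that case $\|\psi\|_\infty=\|g\|_\infty$.
   Context: Fix an integer $n\ge 1$ and $\Lambda=\{1,\dots,n\}$. Let $\mathcal F$ be the set of all finite words in $\Lambda$, i.e. functions $f:\{1,\dots,k\}\to\Lambda$, $k\ge 0$, the empty word being denoted $0$. The full Fock space $\mathcal F^2(\mathcal H_n)$ is the complex Hilbert space with orthonormal basis $\{e_f: f\in\mathcal F\}$, where $e_0=1$ and $e_f=e_{f(1)}\otimes\cdots\otimes e_{f(k)}$. The product $\otimes$ is the bilinear extension of concatenation of words: $\langle \varphi\otimes\psi,e_h\rangle=\sum_{e_f\otimes e_g=e_h}\langle\varphi,e_f\rangle\langle\psi,e_g\rangle$ (a finite sum; in general $\varphi\otimes\psi$ is a formal series). $\mathcal P=\mathrm{span}\{e_f:f\in\mathcal F\}$ is the set of polynomials in the non-commuting indeterminates $e_1,\dots,e_n$. $\|\cdot\|_2$ is the norm of $\mathcal F^2(\mathcal H_n)$. $F^\infty$ is the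 set of all $g\in\mathcal F^2(\mathcal H_n)$ with $\|g\|_\infty=\sup\{\|g\otimes p\|_2: p\in\mathcal P,\ \|p\|_2\le 1\}<\infty$; it is a Banach algebra under $\otimes$, and $\varphi\otimes h\in\mathcal F^2(\mathcal H_n)$ for $\varphi\in F^\infty$, $h\in\mathcal F^2(\mathcal H_n)$. $\varphi\in F^\infty$ is inner if $h\mapsto\varphi\otimes h$ is an isometry on $\mathcal F^2(\mathcal H_n)$. $g\in\mathcal F^2(\mathcal H_n)$ is outer if $g\otimes\mathcal P=\{g\otimes p:p\in\mathcal P\}$ is dense in $\mathcal F^2(\mathcal H_n)$. *)

theory Defs
  imports "HOL-Analysis.Analysis"
begin

text \<open>
  The alphabet \<open>\<Lambda> = {1, ..., n}\<close> with \<open>n \<ge> 1\<close> is a finite (automatically nonempty) type \<open>'n\<close>,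
  and words are lists over it.  A formal series \<open>\<Sum>\<^sub>f a\<^sub>f e\<^sub>f\<close> is represented by its coefficient
  function \<open>f \<mapsto> a\<^sub>f\<close>, so that for an element \<open>\<phi>\<close> of the Fock space \<open>\<phi> f\<close> is the inner product
  of \<open>\<phi>\<close> with \<open>e\<^sub>f\<close>.
\<close>

type_synonym 'n series = "'n list \<Rightarrow> complex"

definition fock :: "('n::finite) series set" where
  "fock = {\<phi>. (\<lambda>f. (cmod (\<phi> f))\<^sup>2) summable_on UNIV}"

text \<open>Only meaningful on \<^const>\<open>fock\<close>: an infinite sum that diverges has the value 0.\<close>

definition norm2 :: "('n::finite) series \<Rightarrow> real" where
  "norm2 \<phi> = sqrt (\<Sum>\<^sub>\<infinity>f\<in>UNIV. (cmod (\<phi> f))\<^sup>2)"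

definition word_vec :: "('n::finite) list \<Rightarrow> 'n series" where
  "word_vec f = (\<lambda>h. if h = f then 1 else 0)"

definition fock_mult :: "('n::finite) series \<Rightarrow> 'n series \<Rightarrow> 'n series"
    (infixl \<open>\<otimes>\<^sub>F\<close> 70) where
  "\<phi> \<otimes>\<^sub>F \<psi> = (\<lambda>h. \<Sum>(f, g) \<in> {(f, g). f @ g = h}. \<phi> f * \<psi> g)"

text \<open>The complex linear span of the basis vectors.\<close>

definition polynomials :: "('n::finite) series set" where
  "polynomials = {(\<lambda>h. \<Sum>f\<in>A. c f * word_vec f h) | A c. finite A}"

text \<open>
  For \<open>g \<in> fock\<close> and a polynomial \<open>p\<close> the product \<open>g \<otimes>\<^sub>F p\<close> is a finite linear combination of
  copies of \<open>g\<close> with shifted coefficients, hence lies in \<^const>\<open>fock\<close>, so \<^const>\<open>norm2\<close> is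
  its Hilbert space norm.
\<close>

definition norm_infty :: "('n::finite) series \<Rightarrow> ennreal" where
  "norm_infty g = (SUP p \<in> {p \<in> polynomials. norm2 p \<le> 1}. ennreal (norm2 (g \<otimes>\<^sub>F p)))"

definition F_infty :: "('n::finite) series set" where
  "F_infty = {g \<in> fock. norm_infty g < \<infinity>}"

text \<open>The map \<open>h \<mapsto> \<phi> \<otimes>\<^sub>F h\<close> is linear, so being an isometry means preserving the norm.\<close>

definition inner_series :: "('n::finite) series \<Rightarrow> bool" where
  "inner_series \<phi> \<longleftrightarrow> \<phi> \<in> F_infty \<and>
     (\<forall>h\<in>fock. \<phi> \<otimes>\<^sub>F h \<in> fock \<and> norm2 (\<phi> \<otimes>\<^sub>F h) = norm2 h)"

definition dense_in_fock :: "('n::finite) series set \<Rightarrow> bool" where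
  "dense_in_fock S \<longleftrightarrow> S \<subseteq> fock \<and>
     (\<forall>h\<in>fock. \<forall>\<epsilon>>0. \<exists>s\<in>S. norm2 (\<lambda>w. h w - s w) < \<epsilon>)"

definition outer_series :: "('n::finite) series \<Rightarrow> bool" where
  "outer_series g \<longleftrightarrow> g \<in> fock \<and> dense_in_fock {g \<otimes>\<^sub>F p | p. p \<in> polynomials}"

end

theory Submission
  imports Defs
begin

text \<open>
  Right multiplications by letters are isometries of the Fock space with mutually orthogonal
  ranges, and they commute with left multiplication.  The factorization is the Wold decomposition
  of these isometries on the cyclic subspace \<open>M\<close>, the closure of \<open>\<psi> \<otimes> \<P>\<close>.

  Let \<open>N\<close> be the closure of the products \<open>\<psi> \<otimes> p\<close> with \<open>p\<close> a polynomial without constant term, and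
  let \<open>d\<close> be the component of \<open>\<psi>\<close> orthogonal to \<open>N\<close>; it spans the wandering subspace of \<open>M\<close>.  Since
  \<open>d \<otimes> p\<close> lies in \<open>N\<close> whenever \<open>p\<close> has no constant term, an induction on the degree shows that
  \<open>p \<mapsto> d \<otimes> p\<close> multiplies norms by \<open>\<parallel>d\<parallel>\<close> (\<open>norm_right_mult_wandering\<close>), and so \<open>d / \<parallel>d\<parallel>\<close> is
  inner once \<open>d \<noteq> 0\<close> (\<open>inner_seriesI\<close>).  On the other hand the products \<open>d \<otimes> p\<close> are
  total in \<open>M\<close> (\<open>wandering_vector_generates\<close>).  Indeed, a vector of \<open>M\<close> orthogonal to \<open>d\<close> lies in
  \<open>N\<close>, so that it has no constant term and the series left after cutting off a last letter \<open>i\<close> is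
  in \<open>M\<close> again; iterating this on a vector orthogonal to all \<open>d \<otimes> p\<close> reaches every coefficient and
  shows that it is zero.  This gives \<open>d \<noteq> 0\<close>, and it gives \<open>\<psi> = \<phi> \<otimes> g\<close> with \<open>\<phi> = d / \<parallel>d\<parallel>\<close>.
  As \<open>M\<close> is both \<open>\<phi> \<otimes> \<F>\<close>, where \<open>\<F>\<close> is the whole Fock space, and the closure of
  \<open>\<phi> \<otimes> (g \<otimes> \<P>)\<close>, the factor \<open>g\<close> is outer.

  For uniqueness, in any such factorization \<open>M = \<phi> \<otimes> \<F>\<close>.  Two inner factors therefore satisfy
  \<open>\<phi>\<^sub>1 = \<phi>\<^sub>2 \<otimes> h\<close> and \<open>\<phi>\<^sub>2 = \<phi>\<^sub>1 \<otimes> k\<close> with \<open>h\<close> and \<open>k\<close> of norm 1, and comparing coefficients of lowest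
  degree shows that the constant terms of \<open>h\<close> and \<open>k\<close> have product 1.  Hence they are unimodular, and
  \<open>h\<close> is a constant.  Finally \<open>\<parallel>\<psi> \<otimes> p\<parallel> = \<parallel>\<phi> \<otimes> (g \<otimes> p)\<parallel> = \<parallel>g \<otimes> p\<parallel>\<close> for every polynomial \<open>p\<close>,
  which is the last claim.
\<close>

section \<open>Square summable families as a Hilbert space\<close>

typedef 'a l2 = "{x :: 'a \<Rightarrow> complex. (\<lambda>a. (cmod (x a))\<^sup>2) summable_on UNIV}"
  morphisms coef Abs_l2
  by (rule exI[of _ "\<lambda>_. 0"]) simp

setup_lifting type_definition_l2

lemma square_summable_add:
  fixes x y :: "'a \<Rightarrow> complex"
  assumes "(\<lambda>a. (cmod (x a))\<^sup>2) summable_on A" "(\<lambda>a. (cmod (y a))\<^sup>2) summable_on A"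
  shows "(\<lambda>a. (cmod (x a + y a))\<^sup>2) summable_on A"
proof (rule summable_on_comparison_test)
  show "(\<lambda>a. 2 * ((cmod (x a))\<^sup>2 + (cmod (y a))\<^sup>2)) summable_on A"
    by (intro summable_on_cmult_right summable_on_add assms)
  fix a
  have "(cmod (x a + y a))\<^sup>2 \<le> (cmod (x a) + cmod (y a))\<^sup>2"
    by (intro power_mono norm_triangle_ineq) auto
  also have "\<dots> \<le> 2 * ((cmod (x a))\<^sup>2 + (cmod (y a))\<^sup>2)"
    using sum_squares_bound[of "cmod (x a)" "cmod (y a)"] by (simp add: power2_sum)
  finally show "(cmod (x a + y a))\<^sup>2 \<le> 2 * ((cmod (x a))\<^sup>2 + (cmod (y a))\<^sup>2)" .
qed auto

lemma square_summable_cmult: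
  fixes x :: "'a \<Rightarrow> complex"
  assumes "(\<lambda>a. (cmod (x a))\<^sup>2) summable_on A"
  shows "(\<lambda>a. (cmod (c * x a))\<^sup>2) summable_on A"
  using summable_on_cmult_right[OF assms, of "(cmod c)\<^sup>2"]
  by (simp add: norm_mult power_mult_distrib)

lemma coef_square_summable: "(\<lambda>a. (cmod (coef x a))\<^sup>2) summable_on UNIV"
  using coef[of x] by simp

lemma summable_inner_coef: "(\<lambda>a. coef x a \<bullet> coef y a) summable_on UNIV"
proof (rule abs_summable_summable, rule summable_on_comparison_test)
  show "(\<lambda>a. (cmod (coef x a))\<^sup>2 + (cmod (coef y a))\<^sup>2) summable_on UNIV"
    by (intro summable_on_add coef_square_summable)
  fix a
  have "norm (coef x a \<bullet> coef y a) \<le> cmod (coef x a) * cmod (coef y a)"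
    using Cauchy_Schwarz_ineq2 by simp
  also have "\<dots> \<le> (cmod (coef x a))\<^sup>2 + (cmod (coef y a))\<^sup>2"
    using sum_squares_bound[of "cmod (coef x a)" "cmod (coef y a)"]
      zero_le_power2[of "cmod (coef x a)"] zero_le_power2[of "cmod (coef y a)"] by linarith
  finally show "norm (coef x a \<bullet> coef y a) \<le> (cmod (coef x a))\<^sup>2 + (cmod (coef y a))\<^sup>2" .
qed auto

instantiation l2 :: (type) real_vector
begin

lift_definition zero_l2 :: "'a l2" is "\<lambda>_. 0" by simp

lift_definition plus_l2 :: "'a l2 \<Rightarrow> 'a l2 \<Rightarrow> 'a l2" is "\<lambda>x y a. x a + y a"
  by (rule square_summable_add)

lift_definition uminus_l2 :: "'a l2 \<Rightarrow> 'a l2" is "\<lambda>x a. - x a" by simp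

lift_definition minus_l2 :: "'a l2 \<Rightarrow> 'a l2 \<Rightarrow> 'a l2" is "\<lambda>x y a. x a - y a"
  subgoal for x y using square_summable_add[of x UNIV "\<lambda>a. - y a"] by simp
  done

lift_definition scaleR_l2 :: "real \<Rightarrow> 'a l2 \<Rightarrow> 'a l2" is "\<lambda>r x a. complex_of_real r * x a"
  by (rule square_summable_cmult)

instance
  by standard (transfer; simp add: algebra_simps)+

end

text \<open>
  The inner product is the real part of the Hermitian one.  On complex subspaces the two notions of
  orthogonality agree, so the library of real inner product spaces applies; scalar multiplication
  by complex numbers is the separate operation \<open>scaleC_l2\<close>.
\<close>

instantiation l2 :: (type) real_inner
begin

definition inner_l2 :: "'a l2 \<Rightarrow> 'a l2 \<Rightarrow> real"
  where "inner_l2 x y = (\<Sum>\<^sub>\<infinity>a. coef x a \<bullet> coef y a)"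

definition norm_l2 :: "'a l2 \<Rightarrow> real" where "norm_l2 x = sqrt (x \<bullet> x)"
definition dist_l2 :: "'a l2 \<Rightarrow> 'a l2 \<Rightarrow> real" where "dist_l2 x y = norm (x - y)"
definition sgn_l2 :: "'a l2 \<Rightarrow> 'a l2" where "sgn_l2 x = x /\<^sub>R norm x"
definition uniformity_l2 :: "('a l2 \<times> 'a l2) filter"
  where "uniformity_l2 = (INF e\<in>{0 <..}. principal {(x, y). dist x y < e})"
definition open_l2 :: "'a l2 set \<Rightarrow> bool"
  where "open_l2 U = (\<forall>x\<in>U. eventually (\<lambda>(x', y). x' = x \<longrightarrow> y \<in> U) uniformity)"

instance
proof
  fix x y z :: "'a l2" and r :: real
  show "dist x y = norm (x - y)" by (rule dist_l2_def)
  show "sgn x = x /\<^sub>R norm x" by (rule sgn_l2_def)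
  show "uniformity = (INF e\<in>{0 <..}. principal {(x, y::'a l2). dist x y < e})"
    by (rule uniformity_l2_def)
  show "open U = (\<forall>x\<in>U. eventually (\<lambda>(x', y). x' = x \<longrightarrow> y \<in> U) uniformity)" for U :: "'a l2 set"
    by (rule open_l2_def)
  show "x \<bullet> y = y \<bullet> x" by (simp add: inner_l2_def inner_commute)
  show "(x + y) \<bullet> z = x \<bullet> z + y \<bullet> z"
    by (simp add: inner_l2_def plus_l2.rep_eq inner_add_left infsum_add summable_inner_coef)
  have scale: "coef (r *\<^sub>R x) a = r *\<^sub>R coef x a" for a
    by (simp add: scaleR_l2.rep_eq scaleR_conv_of_real)
  show "r *\<^sub>R x \<bullet> y = r * (x \<bullet> y)"
    by (simp add: inner_l2_def scale infsum_cmult_right')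
  show "0 \<le> x \<bullet> x" by (simp add: inner_l2_def infsum_nonneg)
  show "x \<bullet> x = 0 \<longleftrightarrow> x = 0"
  proof
    assume "x \<bullet> x = 0"
    then have "coef x a \<bullet> coef x a = 0" for a
      by (intro nonneg_infsum_le_0D[of "\<lambda>a. coef x a \<bullet> coef x a" UNIV])
         (simp_all add: inner_l2_def summable_inner_coef)
    then show "x = 0" by (intro coef_inject[THEN iffD1] ext) (simp add: zero_l2.rep_eq)
  qed (simp add: inner_l2_def zero_l2.rep_eq)
  show "norm x = sqrt (x \<bullet> x)" by (rule norm_l2_def)
qed

end

lemmas coef_simps [simp] =
  zero_l2.rep_eq plus_l2.rep_eq uminus_l2.rep_eq minus_l2.rep_eq scaleR_l2.rep_eq

lemma norm_l2_square: "(norm x)\<^sup>2 = (\<Sum>\<^sub>\<infinity>a. (cmod (coef x a))\<^sup>2)"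
  by (simp add: power2_norm_eq_inner inner_l2_def)

lemma sum_coef_le_norm: "finite F \<Longrightarrow> (\<Sum>a\<in>F. (cmod (coef x a))\<^sup>2) \<le> (norm x)\<^sup>2"
  unfolding norm_l2_square by (intro finite_sum_le_infsum coef_square_summable) auto

lemma cmod_coef_le_norm: "cmod (coef x a) \<le> norm x"
  using sum_coef_le_norm[of "{a}" x] by - (rule power2_le_imp_le, simp_all)

lemma bounded_linear_coef: "bounded_linear (\<lambda>x. coef x a)"
proof (rule bounded_linear_intro)
  show "norm (coef x a) \<le> norm x * 1" for x :: "'a l2" using cmod_coef_le_norm[of x a] by simp
qed (simp_all add: scaleR_conv_of_real)

lemma l2_eqI: "(\<And>a. coef x a = coef y a) \<Longrightarrow> x = y"
  by (rule coef_inject[THEN iffD1]) (rule ext)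

lemma coef_sum: "coef (\<Sum>i\<in>A. x i) a = (\<Sum>i\<in>A. coef (x i) a)"
  by (induction A rule: infinite_finite_induct) auto

lemma norm_l2_mono:
  assumes "\<And>a. cmod (coef x a) \<le> cmod (coef y a)"
  shows "norm x \<le> norm y"
proof -
  have "(norm x)\<^sup>2 \<le> (norm y)\<^sup>2"
    unfolding norm_l2_square
    by (intro infsum_mono coef_square_summable power_mono assms) auto
  then show ?thesis by (rule power2_le_imp_le) simp
qed

lift_definition scaleC_l2 :: "complex \<Rightarrow> 'a l2 \<Rightarrow> 'a l2" is "\<lambda>c x a. c * x a"
  by (rule square_summable_cmult)

declare scaleC_l2.rep_eq [simp]

lemma norm_scaleC_l2 [simp]: "norm (scaleC_l2 c x) = cmod c * norm x"
proof -
  have "(norm (scaleC_l2 c x))\<^sup>2 = (cmod c * norm x)\<^sup>2"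
    by (simp add: norm_l2_square norm_mult power_mult_distrib infsum_cmult_right')
  then show ?thesis by simp
qed

lemma inner_scaleC_l2: "scaleC_l2 c x \<bullet> y = x \<bullet> scaleC_l2 (cnj c) y"
proof -
  have "(c * a) \<bullet> b = a \<bullet> (cnj c * b)" for a b :: complex
    by (simp add: inner_complex_def algebra_simps)
  then show ?thesis by (simp add: inner_l2_def)
qed

lemma bounded_linear_scaleC_l2: "bounded_linear (scaleC_l2 c)"
proof (rule bounded_linear_intro)
  show "norm (scaleC_l2 c x) \<le> norm x * cmod c" for x :: "'a l2" by simp
qed (auto intro!: l2_eqI simp: algebra_simps)

lemma scaleR_eq_scaleC_l2: "r *\<^sub>R x = scaleC_l2 (complex_of_real r) x"
  by (rule l2_eqI) simp

text \<open>
  Membership and a norm bound together, tested on finite partial sums.  Such bounds survive pointwise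
  limits, which serves both for completeness and for extending isometries beyond the polynomials.
\<close>

lemma l2_of_bounded_sums:
  assumes bound: "\<And>F. finite F \<Longrightarrow> (\<Sum>a\<in>F. (cmod (x a))\<^sup>2) \<le> C\<^sup>2" and "0 \<le> C"
  obtains u where "coef u = x" "norm u \<le> C"
proof -
  have "(\<lambda>a. (cmod (x a))\<^sup>2) summable_on UNIV"
    by (rule nonneg_bdd_above_summable_on) (auto intro!: bdd_aboveI[of _ "C\<^sup>2"] simp: bound)
  then have u: "coef (Abs_l2 x) = x" by (simp add: Abs_l2_inverse)
  have "(norm (Abs_l2 x))\<^sup>2 \<le> C\<^sup>2"
    unfolding norm_l2_square u
    by (rule infsum_le_finite_sums) (fact \<open>_ summable_on _\<close>, simp add: bound)
  then have "norm (Abs_l2 x) \<le> C" using \<open>0 \<le> C\<close> by (rule power2_le_imp_le)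
  with u that show thesis by blast
qed

instance l2 :: (type) complete_space
proof
  fix X :: "nat \<Rightarrow> 'a l2"
  assume X: "Cauchy X"
  have "convergent (\<lambda>n. coef (X n) a)" for a
    by (intro Cauchy_convergent bounded_linear.Cauchy[OF bounded_linear_coef X])
  then obtain x where x: "\<And>a. (\<lambda>n. coef (X n) a) \<longlonglongrightarrow> x a"
    unfolding convergent_def by metis
  have *: "\<exists>N. \<forall>n\<ge>N. \<exists>u. coef u = (\<lambda>a. coef (X n) a - x a) \<and> norm u \<le> e"
    if "e > 0" for e
  proof -
    obtain N where N: "\<And>m n. m \<ge> N \<Longrightarrow> n \<ge> N \<Longrightarrow> norm (X m - X n) < e"
      using X \<open>e > 0\<close> unfolding Cauchy_iff by blast
    have "\<exists>u. coef u = (\<lambda>a. coef (X n) a - x a) \<and> norm u \<le> e" if "n \<ge> N" for n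
    proof -
      have "(\<Sum>a\<in>F. (cmod (coef (X n) a - x a))\<^sup>2) \<le> e\<^sup>2" if "finite F" for F
      proof (rule LIMSEQ_le_const2)
        show "(\<lambda>m. \<Sum>a\<in>F. (cmod (coef (X n) a - coef (X m) a))\<^sup>2)
            \<longlonglongrightarrow> (\<Sum>a\<in>F. (cmod (coef (X n) a - x a))\<^sup>2)"
          by (intro tendsto_intros x)
        have "(\<Sum>a\<in>F. (cmod (coef (X n) a - coef (X m) a))\<^sup>2) \<le> e\<^sup>2" if "m \<ge> N" for m
        proof -
          have "(\<Sum>a\<in>F. (cmod (coef (X n - X m) a))\<^sup>2) \<le> (norm (X n - X m))\<^sup>2"
            using \<open>finite F\<close> by (rule sum_coef_le_norm)
          also have "\<dots> \<le> e\<^sup>2"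
            using N[OF \<open>n \<ge> N\<close> that] by (intro power_mono) auto
          finally show ?thesis by simp
        qed
        then show "\<exists>M. \<forall>m\<ge>M. (\<Sum>a\<in>F. (cmod (coef (X n) a - coef (X m) a))\<^sup>2) \<le> e\<^sup>2" by blast
      qed
      then show ?thesis using l2_of_bounded_sums[of "\<lambda>a. coef (X n) a - x a" e] \<open>e > 0\<close> by auto
    qed
    then show ?thesis by blast
  qed
  obtain n u where u: "coef u = (\<lambda>a. coef (X n) a - x a)" using *[of 1] by auto
  have y: "coef (X n - u) = x" by (simp add: u fun_eq_iff)
  have "X \<longlonglongrightarrow> X n - u"
  proof (rule LIMSEQ_I)
    fix e :: real assume "e > 0"
    with *[of "e/2"] obtain N where
      N: "\<And>m. m \<ge> N \<Longrightarrow> \<exists>v. coef v = (\<lambda>a. coef (X m) a - x a) \<and> norm v \<le> e/2" by auto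
    have "norm (X m - (X n - u)) < e" if m: "m \<ge> N" for m
    proof -
      obtain v where v: "coef v = (\<lambda>a. coef (X m) a - x a)" "norm v \<le> e/2" using N[OF m] by blast
      have "X m - (X n - u) = v"
        by (rule coef_inject[THEN iffD1]) (use y in \<open>auto simp: v fun_eq_iff\<close>)
      then show ?thesis using v \<open>e > 0\<close> by simp
    qed
    then show "\<exists>N. \<forall>m\<ge>N. norm (X m - (X n - u)) < e" by blast
  qed
  then show "convergent X" unfolding convergent_def by blast
qed

lemma subspace_closure:
  fixes S :: "'a::real_normed_vector set"
  assumes "subspace S"
  shows "subspace (closure S)"
proof (rule subspaceI)
  show "0 \<in> closure S" using subspace_0[OF assms] closure_subset by blast
next
  fix x y assume "x \<in> closure S" "y \<in> closure S"
  then obtain f g where "\<forall>n. f n \<in> S" "f \<longlonglongrightarrow> x" "\<forall>n. g n \<in> S" "g \<longlonglongrightarrow> y"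
    unfolding closure_sequential by blast
  then show "x + y \<in> closure S"
    unfolding closure_sequential using subspace_add[OF assms]
    by (intro exI[of _ "\<lambda>n. f n + g n"]) (auto intro: tendsto_add)
next
  fix c and x assume "x \<in> closure S"
  then obtain f where "\<forall>n. f n \<in> S" "f \<longlonglongrightarrow> x" unfolding closure_sequential by blast
  then show "c *\<^sub>R x \<in> closure S"
    unfolding closure_sequential using subspace_scale[OF assms]
    by (intro exI[of _ "\<lambda>n. c *\<^sub>R f n"]) (auto intro: tendsto_scaleR)
qed

lemma bounded_linear_image_closure:
  assumes "bounded_linear f" "x \<in> closure S" "\<And>y. y \<in> S \<Longrightarrow> f y \<in> closure T"
  shows "f x \<in> closure T"
  using image_closure_subset[of S f "closure T"] linear_continuous_on[OF assms(1)] assms(2,3) by blast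

text \<open>
  By the parallelogram law, a sequence in the subspace whose distance to the given point tends to the
  infimum is Cauchy; its limit is a closest point.
\<close>

lemma orthogonal_projection_exists:
  fixes S :: "'a::{real_inner, complete_space} set"
  assumes S: "subspace S" "closed S"
  obtains y where "y \<in> S" "\<And>z. z \<in> S \<Longrightarrow> (x - y) \<bullet> z = 0"
proof -
  define \<delta> where "\<delta> = infdist x S"
  have "S \<noteq> {}" using S(1) subspace_0 by auto
  have \<delta>_le: "\<delta> \<le> dist x z" if "z \<in> S" for z unfolding \<delta>_def using that by (rule infdist_le)
  have "\<delta> \<ge> 0" unfolding \<delta>_def by (rule infdist_nonneg)
  have "\<exists>z\<in>S. dist x z < \<delta> + inverse (real (Suc n))" for n
    using \<open>S \<noteq> {}\<close> cINF_less_iff[of S "dist x" "\<delta> + inverse (real (Suc n))"]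
    by (simp add: \<delta>_def infdist_notempty del: of_nat_Suc)
  then obtain Y where Y: "\<And>n. Y n \<in> S" "\<And>n. dist x (Y n) < \<delta> + inverse (real (Suc n))" by metis
  have Y_lim: "(\<lambda>n. dist x (Y n)) \<longlonglongrightarrow> \<delta>"
  proof (rule tendsto_sandwich[OF _ _ tendsto_const])
    show "(\<lambda>n. \<delta> + inverse (real (Suc n))) \<longlonglongrightarrow> \<delta>"
      using tendsto_add[OF tendsto_const LIMSEQ_inverse_real_of_nat] by simp
  qed (simp_all add: \<delta>_le Y less_imp_le del: of_nat_Suc)
  have par: "(dist (Y m) (Y n))\<^sup>2 \<le> 2 * ((dist x (Y m))\<^sup>2 - \<delta>\<^sup>2) + 2 * ((dist x (Y n))\<^sup>2 - \<delta>\<^sup>2)" for m n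
  proof -
    have "(1/2) *\<^sub>R (Y m + Y n) \<in> S" using S(1) Y by (intro subspace_scale subspace_add)
    then have "\<delta>\<^sup>2 \<le> (dist x ((1/2) *\<^sub>R (Y m + Y n)))\<^sup>2" using \<delta>_le \<open>\<delta> \<ge> 0\<close> by (intro power_mono)
    moreover have "(dist (Y m) (Y n))\<^sup>2 + 4 * (dist x ((1/2) *\<^sub>R (Y m + Y n)))\<^sup>2
        = 2 * (dist x (Y m))\<^sup>2 + 2 * (dist x (Y n))\<^sup>2"
      by (simp add: dist_norm power2_norm_eq_inner inner_simps inner_commute algebra_simps)
    ultimately show ?thesis by simp
  qed
  have "Cauchy Y"
  proof (rule metric_CauchyI)
    fix e :: real assume "e > 0"
    have "(\<lambda>n. 2 * ((dist x (Y n))\<^sup>2 - \<delta>\<^sup>2)) \<longlonglongrightarrow> 2 * (\<delta>\<^sup>2 - \<delta>\<^sup>2)"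
      by (intro tendsto_intros Y_lim)
    then have "(\<lambda>n. 2 * ((dist x (Y n))\<^sup>2 - \<delta>\<^sup>2)) \<longlonglongrightarrow> 0" by simp
    then have "\<forall>\<^sub>F n in sequentially. 2 * ((dist x (Y n))\<^sup>2 - \<delta>\<^sup>2) < e\<^sup>2 / 2"
      using \<open>e > 0\<close> by (intro order_tendstoD(2)) auto
    then obtain N where N: "\<And>n. n \<ge> N \<Longrightarrow> 2 * ((dist x (Y n))\<^sup>2 - \<delta>\<^sup>2) < e\<^sup>2 / 2"
      unfolding eventually_sequentially by blast
    have "dist (Y m) (Y n) < e" if "m \<ge> N" "n \<ge> N" for m n
    proof -
      have "(dist (Y m) (Y n))\<^sup>2 < e\<^sup>2" using par[of m n] N[OF that(1)] N[OF that(2)] by simp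
      then show ?thesis by (rule power_less_imp_less_base) (use \<open>e > 0\<close> in simp)
    qed
    then show "\<exists>N. \<forall>m\<ge>N. \<forall>n\<ge>N. dist (Y m) (Y n) < e" by blast
  qed
  then obtain y where y: "Y \<longlonglongrightarrow> y" using Cauchy_convergent convergent_def by blast
  have "y \<in> S" using S(2) Y(1) y closed_sequentially by blast
  have "dist x y = \<delta>" using LIMSEQ_unique[OF Y_lim] tendsto_dist[OF tendsto_const y] by metis
  then have min: "\<forall>z\<in>S. dist x y \<le> dist x z" using \<delta>_le by simp
  have le: "(x - y) \<bullet> z \<le> 0" if "z \<in> S" for z
    using any_closest_point_dot[OF subspace_imp_convex[OF S(1)] S(2) \<open>y \<in> S\<close> _ min, of "y + z"]
      S(1) \<open>y \<in> S\<close> that by (simp add: subspace_add)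
  have "(x - y) \<bullet> z = 0" if "z \<in> S" for z
    using le[OF that] le[of "- z"] subspace_neg[OF S(1) that] by simp
  with \<open>y \<in> S\<close> show thesis by (rule that)
qed

section \<open>Removing and appending a last letter\<close>

text \<open>
  The adjoint of right multiplication by the letter \<open>i\<close>, which is \<open>snoc_shift\<close> below.
\<close>

definition strip :: "'n \<Rightarrow> ('n list \<Rightarrow> 'c) \<Rightarrow> 'n list \<Rightarrow> 'c"
  where "strip i x = (\<lambda>w. x (w @ [i]))"

definition snoc_shift :: "'n \<Rightarrow> ('n list \<Rightarrow> 'c::zero) \<Rightarrow> 'n list \<Rightarrow> 'c"
  where "snoc_shift i x = (\<lambda>w. if w \<noteq> [] \<and> last w = i then x (butlast w) else 0)"

lemma snoc_shift_Nil [simp]: "snoc_shift i x [] = 0"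
  and snoc_shift_snoc [simp]: "snoc_shift i x (w @ [j]) = (if i = j then x w else 0)"
  by (auto simp: snoc_shift_def)

lemma strip_snoc_shift [simp]: "strip i (snoc_shift j x) = (if i = j then x else (\<lambda>_. 0))"
  by (auto simp: strip_def)

text \<open>
  A series is determined by its constant term and its strips.  With the formula for the strips of
  a product, this reduces identities between products to induction over words from the right.
\<close>

lemma series_eqI:
  assumes "x [] = y []" "\<And>i. strip i x = strip i y"
  shows "x = y"
proof
  fix w show "x w = y w"
  proof (cases w rule: rev_cases)
    case (snoc v i)
    then show ?thesis using assms(2)[of i] by (simp add: strip_def fun_eq_iff)
  qed (simp add: assms(1))
qed

section \<open>The product of formal series\<close>

lemma splits_Nil: "{(f, g). f @ g = []} = {([], [])}"
  by auto

lemma splits_snoc: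
  "{(f, g). f @ g = w @ [i]} = insert (w @ [i], []) ((\<lambda>(f, g). (f, g @ [i])) ` {(f, g). f @ g = w})"
  (is "?L = ?R")
proof
  show "?L \<subseteq> ?R"
  proof clarify
    fix f g assume *: "f @ g = w @ [i]" "(f, g) \<notin> (\<lambda>(f, g). (f, g @ [i])) ` {(f, g). f @ g = w}"
    then show "f = w @ [i] \<and> g = []" by (cases g rule: rev_cases) force+
  qed
qed auto

lemma finite_splits: "finite {(f, g). f @ g = w}"
proof (induction w rule: rev_induct)
  case Nil
  then show ?case by (simp only: splits_Nil) simp
next
  case (snoc i w)
  then show ?case by (simp only: splits_snoc) simp
qed

lemma fock_mult_Nil [simp]: "(x \<otimes>\<^sub>F y) [] = x [] * y []"
  unfolding fock_mult_def splits_Nil by simp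

text \<open>
  In a splitting of the word extended by \<open>i\<close>, either the second part is empty or it ends
  with \<open>i\<close>.
\<close>

lemma fock_mult_snoc: "(x \<otimes>\<^sub>F y) (w @ [i]) = (x \<otimes>\<^sub>F strip i y) w + x (w @ [i]) * y []"
proof -
  have inj: "inj_on (\<lambda>(f, g). (f, g @ [i])) {(f, g). f @ g = w}" by (auto simp: inj_on_def)
  have "(w @ [i], []) \<notin> (\<lambda>(f, g). (f, g @ [i])) ` {(f, g). f @ g = w}" by auto
  then have "(x \<otimes>\<^sub>F y) (w @ [i]) = x (w @ [i]) * y []
      + (\<Sum>(f, g)\<in>(\<lambda>(f, g). (f, g @ [i])) ` {(f, g). f @ g = w}. x f * y g)"
    unfolding fock_mult_def splits_snoc by (subst sum.insert) (simp_all add: finite_splits)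
  also have "(\<Sum>(f, g)\<in>(\<lambda>(f, g). (f, g @ [i])) ` {(f, g). f @ g = w}. x f * y g) = (x \<otimes>\<^sub>F strip i y) w"
    unfolding fock_mult_def by (subst sum.reindex[OF inj]) (simp add: strip_def case_prod_unfold)
  finally show ?thesis by simp
qed

lemma strip_fock_mult: "strip i (x \<otimes>\<^sub>F y) = (\<lambda>w. (x \<otimes>\<^sub>F strip i y) w + y [] * strip i x w)"
  by (simp add: strip_def fock_mult_snoc fun_eq_iff)

lemma fock_mult_add_left: "(\<lambda>w. x w + y w) \<otimes>\<^sub>F z = (\<lambda>w. (x \<otimes>\<^sub>F z) w + (y \<otimes>\<^sub>F z) w)"
  by (simp add: fock_mult_def case_prod_unfold distrib_right sum.distrib)

lemma fock_mult_add_right: "z \<otimes>\<^sub>F (\<lambda>w. x w + y w) = (\<lambda>w. (z \<otimes>\<^sub>F x) w + (z \<otimes>\<^sub>F y) w)"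
  by (simp add: fock_mult_def case_prod_unfold distrib_left sum.distrib)

lemma fock_mult_cmult_left: "(\<lambda>w. c * x w) \<otimes>\<^sub>F z = (\<lambda>w. c * (x \<otimes>\<^sub>F z) w)"
  by (simp add: fock_mult_def case_prod_unfold sum_distrib_left mult.assoc)

lemma fock_mult_cmult_right: "z \<otimes>\<^sub>F (\<lambda>w. c * x w) = (\<lambda>w. c * (z \<otimes>\<^sub>F x) w)"
  by (simp add: fock_mult_def case_prod_unfold sum_distrib_left mult.left_commute)

lemma fock_mult_diff_right: "z \<otimes>\<^sub>F (\<lambda>w. x w - y w) = (\<lambda>w. (z \<otimes>\<^sub>F x) w - (z \<otimes>\<^sub>F y) w)"
  using fock_mult_add_right[of z x "\<lambda>w. (-1) * y w"]
  unfolding fock_mult_cmult_right by simp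

lemma fock_mult_zero_right [simp]: "x \<otimes>\<^sub>F (\<lambda>_. 0) = (\<lambda>_. 0)"
  by (simp add: fock_mult_def)

lemma fock_mult_assoc: "(x \<otimes>\<^sub>F y) \<otimes>\<^sub>F z = x \<otimes>\<^sub>F (y \<otimes>\<^sub>F z)"
proof
  fix w show "((x \<otimes>\<^sub>F y) \<otimes>\<^sub>F z) w = (x \<otimes>\<^sub>F (y \<otimes>\<^sub>F z)) w"
  proof (induction w arbitrary: y z rule: rev_induct)
    case (snoc i w)
    show ?case
      by (simp add: fock_mult_snoc snoc strip_fock_mult fock_mult_add_right fock_mult_cmult_right
          algebra_simps)
  qed simp
qed

lemma fock_mult_one_right [simp]: "x \<otimes>\<^sub>F word_vec [] = x"
proof (rule series_eqI)
  have [simp]: "strip i (word_vec []) = (\<lambda>_. 0)" for i :: 'a by (simp add: strip_def word_vec_def)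
  show "strip i (x \<otimes>\<^sub>F word_vec []) = strip i x" for i
    by (simp add: strip_fock_mult) (simp add: word_vec_def)
qed (simp add: word_vec_def)

text \<open>
  Expands right multiplication by \<open>y\<close> into the constant term of \<open>y\<close> and letter shifts, so that
  statements about right multiplication by a polynomial follow by induction.
\<close>

lemma fock_mult_decompose:
  fixes x y :: "('n::finite) series"
  shows "x \<otimes>\<^sub>F y = (\<lambda>w. y [] * x w + (\<Sum>i\<in>UNIV. snoc_shift i (x \<otimes>\<^sub>F strip i y) w))"
  by (rule series_eqI) (simp_all add: strip_fock_mult, simp add: strip_def fun_eq_iff)

lemma fock_mult_cong_length:
  assumes "\<And>v. length v \<le> length w \<Longrightarrow> y v = z v"
  shows "(x \<otimes>\<^sub>F y) w = (x \<otimes>\<^sub>F z) w"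
  unfolding fock_mult_def by (intro sum.cong refl) (auto simp: assms)

text \<open>
  Every splitting other than the one with an empty second part uses a shorter prefix, where \<open>x\<close>
  vanishes.
\<close>

lemma fock_mult_lowest_coef:
  assumes "\<And>v. length v < length w \<Longrightarrow> x v = 0"
  shows "(x \<otimes>\<^sub>F y) w = x w * y []"
proof (cases w rule: rev_cases)
  case (snoc v i)
  have "(x \<otimes>\<^sub>F strip i y) v = 0"
    unfolding fock_mult_def by (rule sum.neutral) (auto simp: assms snoc)
  then show ?thesis by (simp add: snoc fock_mult_snoc)
qed simp

section \<open>Polynomials\<close>

lemma polynomials_iff_finite_support: "p \<in> polynomials \<longleftrightarrow> finite {w. p w \<noteq> 0}"
proof
  assume "p \<in> polynomials"
  then obtain A c where A: "finite A" "p = (\<lambda>h. \<Sum>f\<in>A. c f * word_vec f h)"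
    unfolding polynomials_def by blast
  have "p w = 0" if "w \<notin> A" for w
    unfolding A(2) word_vec_def using that by (auto intro!: sum.neutral)
  then have "{w. p w \<noteq> 0} \<subseteq> A" by blast
  then show "finite {w. p w \<noteq> 0}" using A(1) finite_subset by blast
next
  assume "finite {w. p w \<noteq> 0}"
  moreover from this have "p = (\<lambda>h. \<Sum>f\<in>{w. p w \<noteq> 0}. p f * word_vec f h)"
    by (auto simp: word_vec_def fun_eq_iff if_distrib[of "\<lambda>c. _ * c"] cong: if_cong)
  ultimately show "p \<in> polynomials" unfolding polynomials_def by blast
qed

lemma polynomials_iff_bounded_length: "p \<in> polynomials \<longleftrightarrow> (\<exists>k. \<forall>w. p w \<noteq> 0 \<longrightarrow> length w < k)"
proof
  assume "p \<in> polynomials"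
  then have "finite (length ` {w. p w \<noteq> 0})" by (simp add: polynomials_iff_finite_support)
  then show "\<exists>k. \<forall>w. p w \<noteq> 0 \<longrightarrow> length w < k"
    unfolding finite_nat_set_iff_bounded by auto
next
  assume "\<exists>k. \<forall>w. p w \<noteq> 0 \<longrightarrow> length w < k"
  then obtain k where "{w. p w \<noteq> 0} \<subseteq> {w. set w \<subseteq> UNIV \<and> length w \<le> k}" by (auto intro: less_imp_le)
  then show "p \<in> polynomials"
    unfolding polynomials_iff_finite_support by (rule finite_subset) (rule finite_lists_length_le[OF finite])
qed

lemma strip_polynomials: "p \<in> polynomials \<Longrightarrow> strip i p \<in> polynomials"
  unfolding polynomials_iff_bounded_length strip_def by (metis length_append_singleton lessI order.strict_trans)

text \<open>
  Induction on the degree: stripping a letter lowers it.  The zero series must be a base case, being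
  its own strip.
\<close>

lemma polynomials_induct [consumes 1, case_names zero step]:
  fixes p :: "('n::finite) series"
  assumes "p \<in> polynomials" and zero: "P (\<lambda>_. 0)"
    and step: "\<And>p. p \<in> polynomials \<Longrightarrow> (\<And>i. P (strip i p)) \<Longrightarrow> P p"
  shows "P p"
proof -
  obtain k where "\<forall>w. p w \<noteq> 0 \<longrightarrow> length w < k"
    using assms(1) unfolding polynomials_iff_bounded_length by blast
  then show ?thesis
  proof (induction k arbitrary: p)
    case 0
    then have "p = (\<lambda>_. 0)" by auto
    then show ?case using zero by simp
  next
    case (Suc k)
    show ?case
    proof (rule step)
      show "p \<in> polynomials" using Suc.prems unfolding polynomials_iff_bounded_length by blast
      show "P (strip i p)" for i using Suc.prems by (intro Suc.IH) (auto simp: strip_def)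
    qed
  qed
qed

lemma polynomials_closed:
  fixes p q :: "('n::finite) series"
  shows polynomials_zero [simp]: "(\<lambda>_. 0 :: complex) \<in> (polynomials :: 'n series set)"
    and polynomials_add: "p \<in> polynomials \<Longrightarrow> q \<in> polynomials \<Longrightarrow> (\<lambda>w. p w + q w) \<in> polynomials"
    and polynomials_cmult: "p \<in> polynomials \<Longrightarrow> (\<lambda>w. c * p w) \<in> polynomials"
    and polynomials_snoc_shift: "p \<in> polynomials \<Longrightarrow> snoc_shift i p \<in> polynomials"
    and polynomials_word_vec [simp]: "word_vec f \<in> polynomials"
proof -
  show "(\<lambda>w. p w + q w) \<in> polynomials" if "p \<in> polynomials" "q \<in> polynomials"
  proof -
    have "{w. p w + q w \<noteq> 0} \<subseteq> {w. p w \<noteq> 0} \<union> {w. q w \<noteq> 0}" by auto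
    then show ?thesis using that unfolding polynomials_iff_finite_support by (simp add: finite_subset)
  qed
  show "(\<lambda>w. c * p w) \<in> polynomials" if "p \<in> polynomials"
    using that unfolding polynomials_iff_finite_support by (rule rev_finite_subset) auto
  show "snoc_shift i p \<in> polynomials" if p: "p \<in> polynomials"
  proof -
    obtain k where k: "\<forall>w. p w \<noteq> 0 \<longrightarrow> length w < k"
      using p unfolding polynomials_iff_bounded_length by blast
    have "length w < Suc k" if "snoc_shift i p w \<noteq> 0" for w
      using that k by (cases w rule: rev_cases) (auto split: if_splits)
    then show ?thesis unfolding polynomials_iff_bounded_length by blast
  qed
qed (auto simp: polynomials_iff_finite_support word_vec_def)

lemma polynomials_sum:
  assumes "\<And>i. i \<in> A \<Longrightarrow> p i \<in> polynomials"
  shows "(\<lambda>w. \<Sum>i\<in>A. p i w) \<in> polynomials"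
  using assms by (induction A rule: infinite_finite_induct) (simp_all add: polynomials_closed)

lemma polynomials_fock_mult:
  assumes "q \<in> polynomials" "p \<in> polynomials"
  shows "q \<otimes>\<^sub>F p \<in> polynomials"
  using assms(2)
proof (induction p rule: polynomials_induct)
  case (step p)
  show ?case
    by (subst fock_mult_decompose)
       (intro polynomials_add polynomials_cmult polynomials_sum polynomials_snoc_shift step assms(1))
qed (simp add: polynomials_zero)

section \<open>The Fock space and right multiplication by polynomials\<close>

lemma strip_square_summable:
  "(\<lambda>w. (cmod (x w))\<^sup>2) summable_on UNIV \<Longrightarrow> (\<lambda>w. (cmod (strip i x w))\<^sup>2) summable_on UNIV"
  using summable_on_reindex[of "\<lambda>w. w @ [i]" UNIV "\<lambda>w. (cmod (x w))\<^sup>2"]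
    summable_on_subset_banach[of "\<lambda>w. (cmod (x w))\<^sup>2" UNIV "range (\<lambda>w. w @ [i])"]
  by (simp add: strip_def o_def inj_on_def)

lemma snoc_shift_square_summable:
  assumes "(\<lambda>w. (cmod (x w))\<^sup>2) summable_on UNIV"
  shows "(\<lambda>w. (cmod (snoc_shift i x w))\<^sup>2) summable_on UNIV"
proof -
  have "(\<lambda>w. (cmod (snoc_shift i x w))\<^sup>2) summable_on range (\<lambda>w. w @ [i])"
    using assms by (subst summable_on_reindex) (simp_all add: o_def inj_on_def)
  moreover have "w \<in> range (\<lambda>w. w @ [i])" if "(cmod (snoc_shift i x w))\<^sup>2 \<noteq> 0" for w
    using that by (cases w rule: rev_cases) (auto split: if_splits)
  ultimately show ?thesis
    by (subst summable_on_cong_neutral[where T = "range (\<lambda>w. w @ [i])"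
          and g = "\<lambda>w. (cmod (snoc_shift i x w))\<^sup>2"]) blast+
qed

lemma infsum_words:
  fixes f :: "('n::finite) list \<Rightarrow> real"
  assumes f: "f summable_on UNIV"
  shows "(\<Sum>\<^sub>\<infinity>w. f w) = f [] + (\<Sum>i\<in>UNIV. \<Sum>\<^sub>\<infinity>w. f (w @ [i]))"
proof -
  define h :: "'n \<times> 'n list \<Rightarrow> 'n list" where "h = (\<lambda>(i, w). w @ [i])"
  have inj: "inj h" by (auto simp: h_def inj_def)
  have UNIV: "UNIV = insert [] (range h)"
  proof -
    have "w \<in> insert [] (range h)" for w
      by (cases w rule: rev_cases) (auto simp: h_def image_def)
    then show ?thesis by blast
  qed
  have h: "f summable_on range h" using f by (rule summable_on_subset_banach) simp
  have "(\<Sum>\<^sub>\<infinity>w. f w) = f [] + (\<Sum>\<^sub>\<infinity>w\<in>range h. f w)"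
    by (subst UNIV, subst infsum_insert) (auto simp: h, auto simp: h_def)
  also have "(\<Sum>\<^sub>\<infinity>w\<in>range h. f w) = (\<Sum>\<^sub>\<infinity>p\<in>UNIV \<times> UNIV. f (h p))"
    by (subst infsum_reindex[OF inj]) (simp add: o_def)
  also have "\<dots> = (\<Sum>\<^sub>\<infinity>i\<in>UNIV. \<Sum>\<^sub>\<infinity>w\<in>UNIV. f (h (i, w)))"
    using h summable_on_reindex[OF inj, of f] by (intro infsum_Sigma_banach[symmetric]) (simp add: o_def)
  also have "\<dots> = (\<Sum>i\<in>UNIV. \<Sum>\<^sub>\<infinity>w. f (w @ [i]))" by (simp add: h_def)
  finally show ?thesis .
qed

lift_definition strip_l2 :: "'n \<Rightarrow> 'n list l2 \<Rightarrow> 'n list l2" is strip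
  by (rule strip_square_summable)

lift_definition snoc_l2 :: "'n \<Rightarrow> 'n list l2 \<Rightarrow> 'n list l2" is snoc_shift
  by (rule snoc_shift_square_summable)

lemmas l2_ops_simps [simp] = strip_l2.rep_eq snoc_l2.rep_eq

lemma inner_l2_words:
  fixes x y :: "('n::finite) list l2"
  shows "x \<bullet> y = coef x [] \<bullet> coef y [] + (\<Sum>i\<in>UNIV. strip_l2 i x \<bullet> strip_l2 i y)"
  unfolding inner_l2_def
  by (subst infsum_words[OF summable_inner_coef]) (simp add: strip_def)

text \<open>
  The Pythagorean form of the decomposition of the Fock space into the constants and the ranges of
  the right multiplications by letters.
\<close>

lemma norm_l2_words:
  fixes x :: "('n::finite) list l2"
  shows "(norm x)\<^sup>2 = (cmod (coef x []))\<^sup>2 + (\<Sum>i\<in>UNIV. (norm (strip_l2 i x))\<^sup>2)"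
  by (simp add: power2_norm_eq_inner inner_l2_words[of x])

lemma norm_snoc_l2 [simp]: "norm (snoc_l2 i x) = norm (x :: ('n::finite) list l2)"
proof -
  have *: "strip_l2 j (snoc_l2 i x) = (if i = j then x else 0)" for j
    by (rule l2_eqI) simp
  have "(norm (snoc_l2 i x))\<^sup>2 = (norm x)\<^sup>2"
    by (simp add: norm_l2_words[of "snoc_l2 i x"] * if_distrib[of norm] if_distrib[of "\<lambda>r. r\<^sup>2"] cong: if_cong)
  then show ?thesis by simp
qed

lemma bounded_linear_strip_l2: "bounded_linear (strip_l2 (i :: 'n::finite))"
proof (rule bounded_linear_intro)
  fix x :: "'n list l2"
  have "(norm (strip_l2 i x))\<^sup>2 \<le> (norm x)\<^sup>2"
    unfolding norm_l2_words[of x] by (rule add_increasing) (auto intro: member_le_sum)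
  then show "norm (strip_l2 i x) \<le> norm x * 1" by (simp add: power2_le_iff_abs_le)
qed (auto intro!: l2_eqI simp: strip_def)

lemma fock_eq_range_coef: "fock = range coef"
  using type_definition.Rep_range[OF type_definition_l2] unfolding fock_def by blast

lemma fock_obtain_coef:
  assumes "x \<in> fock"
  obtains u where "coef u = x"
  using assms unfolding fock_eq_range_coef by blast

lemma norm2_coef: "norm2 (coef x) = norm x"
  by (simp add: norm2_def norm_l2_square[symmetric])

lemma coef_in_fock [simp]: "coef x \<in> fock" by (simp add: fock_eq_range_coef)

lemma polynomials_in_fock: "p \<in> polynomials \<Longrightarrow> p \<in> fock"
proof -
  assume "p \<in> polynomials"
  then have "(\<lambda>f. (cmod (p f))\<^sup>2) summable_on {w. p w \<noteq> 0}"
    by (simp add: polynomials_iff_finite_support)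
  then show "p \<in> fock"
    unfolding fock_def mem_Collect_eq
    by (subst summable_on_cong_neutral[where T = "{w. p w \<noteq> 0}" and g = "\<lambda>f. (cmod (p f))\<^sup>2"]) auto
qed

text \<open>
  Meaningful for polynomials \<open>p\<close> only: otherwise the product need not be square summable, and the
  value is unspecified.
\<close>

definition right_mult :: "('n::finite) series \<Rightarrow> 'n list l2 \<Rightarrow> 'n list l2"
  where "right_mult p x = Abs_l2 (coef x \<otimes>\<^sub>F p)"

text \<open>
  Each letter shift is an isometry, so expanding by \<open>fock_mult_decompose\<close> bounds the norm of
  the product by that of \<open>x\<close> times the sum of the moduli of the coefficients of \<open>p\<close>.
\<close>

lemma right_mult_bound:
  fixes p :: "('n::finite) series"
  assumes "p \<in> polynomials"
  shows "\<exists>C. \<forall>x. \<exists>y. coef y = coef x \<otimes>\<^sub>F p \<and> norm y \<le> norm x * C"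
  using assms
proof (induction p rule: polynomials_induct)
  case zero
  then show ?case by (auto intro!: exI[of _ 0] exI[of _ "0 :: 'n list l2"])
next
  case (step p)
  obtain C where C: "\<And>i x. \<exists>y. coef y = coef x \<otimes>\<^sub>F strip i p \<and> norm y \<le> norm x * C i"
    using step(2) by metis
  have "\<exists>y. coef y = coef x \<otimes>\<^sub>F p \<and> norm y \<le> norm x * (cmod (p []) + (\<Sum>i\<in>UNIV. C i))" for x
  proof -
    obtain y where y: "\<And>i. coef (y i) = coef x \<otimes>\<^sub>F strip i p" "\<And>i. norm (y i) \<le> norm x * C i"
      using C[of x] by metis
    let ?y = "scaleC_l2 (p []) x + (\<Sum>i\<in>UNIV. snoc_l2 i (y i))"
    have "norm ?y \<le> norm (scaleC_l2 (p []) x) + (\<Sum>i\<in>UNIV. norm (snoc_l2 i (y i)))"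
      by (intro order.trans[OF norm_triangle_ineq] add_left_mono norm_sum)
    also have "\<dots> \<le> cmod (p []) * norm x + (\<Sum>i\<in>UNIV. norm x * C i)"
      by (intro add_mono sum_mono) (simp_all add: y)
    also have "\<dots> = norm x * (cmod (p []) + (\<Sum>i\<in>UNIV. C i))"
      by (simp add: algebra_simps sum_distrib_left)
    finally have "norm ?y \<le> norm x * (cmod (p []) + (\<Sum>i\<in>UNIV. C i))" .
    moreover have "coef ?y = coef x \<otimes>\<^sub>F p"
      by (subst fock_mult_decompose) (simp add: fun_eq_iff coef_sum y)
    ultimately show ?thesis by blast
  qed
  then show ?case by blast
qed

lemma coef_right_mult [simp]:
  assumes "p \<in> polynomials"
  shows "coef (right_mult p x) = coef x \<otimes>\<^sub>F p"
  using right_mult_bound[OF assms] unfolding right_mult_def by (metis coef_inverse)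

lemma bounded_linear_right_mult:
  assumes p: "p \<in> polynomials"
  shows "bounded_linear (right_mult p)"
proof -
  obtain C where C: "\<And>x. norm (right_mult p x) \<le> norm x * C"
    using right_mult_bound[OF p] coef_right_mult[OF p] by (metis coef_inject)
  show ?thesis
    by (rule bounded_linear_intro[OF _ _ C])
       (auto intro!: l2_eqI simp: p fock_mult_add_left fock_mult_cmult_left)
qed

section \<open>Cyclic subspaces and wandering vectors\<close>

definition cyclic :: "('n::finite) list l2 \<Rightarrow> 'n list l2 set"
  where "cyclic u = closure ((\<lambda>p. right_mult p u) ` polynomials)"

text \<open>
  For \<open>M = cyclic u\<close> this is the closed span of the products of elements of \<open>M\<close> with letters; its
  orthogonal complement in \<open>M\<close> is the wandering subspace of the Wold decomposition.
\<close>

definition cyclic_tail :: "('n::finite) list l2 \<Rightarrow> 'n list l2 set"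
  where "cyclic_tail u = closure ((\<lambda>p. right_mult p u) ` {p \<in> polynomials. p [] = 0})"

lemma right_mult_add:
  assumes "p \<in> polynomials" "q \<in> polynomials"
  shows "right_mult (\<lambda>w. p w + q w) x = right_mult p x + right_mult q x"
  by (rule l2_eqI) (simp add: assms polynomials_add fock_mult_add_right)

lemma right_mult_cmult:
  assumes "p \<in> polynomials"
  shows "right_mult (\<lambda>w. c * p w) x = scaleC_l2 c (right_mult p x)"
  by (rule l2_eqI) (simp add: assms polynomials_cmult fock_mult_cmult_right)

lemma right_mult_right_mult:
  assumes "p \<in> polynomials" "q \<in> polynomials"
  shows "right_mult p (right_mult q x) = right_mult (q \<otimes>\<^sub>F p) x"
  by (rule l2_eqI) (simp add: assms polynomials_fock_mult fock_mult_assoc)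

lemma right_mult_one [simp]: "right_mult (word_vec []) x = x"
  by (rule l2_eqI) (simp add: polynomials_word_vec)

lemma strip_l2_right_mult:
  assumes "p \<in> polynomials"
  shows "strip_l2 i (right_mult p x) = right_mult (strip i p) x + scaleC_l2 (p []) (strip_l2 i x)"
  by (rule l2_eqI) (simp add: assms strip_polynomials strip_fock_mult)

lemma closure_right_mult_complex_subspace:
  fixes Q :: "('n::finite) series set" and u :: "'n list l2"
  defines "S \<equiv> (\<lambda>p. right_mult p u) ` Q"
  assumes Q: "Q \<subseteq> polynomials" "(\<lambda>_. 0) \<in> Q"
    and add: "\<And>p q. p \<in> Q \<Longrightarrow> q \<in> Q \<Longrightarrow> (\<lambda>w. p w + q w) \<in> Q"
    and cmult: "\<And>c p. p \<in> Q \<Longrightarrow> (\<lambda>w. c * p w) \<in> Q"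
  shows "subspace (closure S)" and "x \<in> closure S \<Longrightarrow> scaleC_l2 c x \<in> closure S"
proof -
  have scale: "scaleC_l2 c y \<in> S" if y: "y \<in> S" for c y
  proof -
    obtain p where p: "p \<in> Q" "y = right_mult p u" using y unfolding S_def by blast
    then have "scaleC_l2 c y = right_mult (\<lambda>w. c * p w) u"
      using Q(1) right_mult_cmult[of p c u] by auto
    with cmult[OF p(1)] show ?thesis unfolding S_def by blast
  qed
  have "subspace S"
  proof (rule subspaceI)
    have "right_mult (\<lambda>_. 0) u = 0" by (rule l2_eqI) (simp add: polynomials_zero)
    with Q(2) show "0 \<in> S" unfolding S_def by (intro image_eqI[of _ _ "\<lambda>_. 0"]) simp_all
  next
    fix y z assume "y \<in> S" "z \<in> S"
    then obtain p q where "p \<in> Q" "y = right_mult p u" "q \<in> Q" "z = right_mult q u"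
      unfolding S_def by blast
    moreover from this have "y + z = right_mult (\<lambda>w. p w + q w) u"
      using Q(1) by (simp add: right_mult_add[of p q u] subset_iff)
    ultimately show "y + z \<in> S"
      unfolding S_def using add[of p q] by simp
  qed (simp add: scaleR_eq_scaleC_l2 scale)
  then show "subspace (closure S)" by (rule subspace_closure)
  show "x \<in> closure S \<Longrightarrow> scaleC_l2 c x \<in> closure S"
    by (rule bounded_linear_image_closure[OF bounded_linear_scaleC_l2]) (use scale closure_subset in blast)+
qed

lemma closed_cyclic: "closed (cyclic u)" "closed (cyclic_tail u)"
  by (simp_all add: cyclic_def cyclic_tail_def)

lemma subspace_cyclic: "subspace (cyclic u)"
  unfolding cyclic_def
  by (intro closure_right_mult_complex_subspace; simp add: polynomials_add polynomials_cmult)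

lemma subspace_cyclic_tail: "subspace (cyclic_tail u)"
  and scaleC_cyclic_tail: "x \<in> cyclic_tail u \<Longrightarrow> scaleC_l2 c x \<in> cyclic_tail u"
  unfolding cyclic_tail_def
  by (intro closure_right_mult_complex_subspace; force simp: polynomials_add polynomials_cmult)+

lemma cyclic_tail_subset: "cyclic_tail u \<subseteq> cyclic u"
  unfolding cyclic_def cyclic_tail_def by (intro closure_mono image_mono) auto

lemma right_mult_in_cyclic: "p \<in> polynomials \<Longrightarrow> right_mult p u \<in> cyclic u"
  unfolding cyclic_def by (rule subsetD[OF closure_subset]) (rule imageI)

lemma generator_in_cyclic: "u \<in> cyclic u"
  using right_mult_in_cyclic[OF polynomials_word_vec[of "[]"], of u] by simp

lemma right_mult_in_cyclic_tail: "p \<in> polynomials \<Longrightarrow> p [] = 0 \<Longrightarrow> right_mult p u \<in> cyclic_tail u"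
  unfolding cyclic_tail_def by (rule subsetD[OF closure_subset]) simp

lemma cyclic_right_mult:
  assumes "x \<in> cyclic u" "p \<in> polynomials"
  shows "right_mult p x \<in> cyclic u"
  unfolding cyclic_def
proof (rule bounded_linear_image_closure[OF bounded_linear_right_mult[OF assms(2)]])
  show "x \<in> closure ((\<lambda>p. right_mult p u) ` polynomials)" using assms(1) by (simp add: cyclic_def)
  show "right_mult p y \<in> closure ((\<lambda>p. right_mult p u) ` polynomials)"
    if "y \<in> (\<lambda>p. right_mult p u) ` polynomials" for y
    using that assms(2)
    by (auto simp: right_mult_right_mult polynomials_fock_mult right_mult_in_cyclic simp flip: cyclic_def)
qed

lemma cyclic_right_mult_tail:
  assumes "x \<in> cyclic u" "p \<in> polynomials" "p [] = 0"
  shows "right_mult p x \<in> cyclic_tail u"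
  unfolding cyclic_tail_def
proof (rule bounded_linear_image_closure[OF bounded_linear_right_mult[OF assms(2)]])
  show "x \<in> closure ((\<lambda>p. right_mult p u) ` polynomials)" using assms(1) by (simp add: cyclic_def)
  show "right_mult p y \<in> closure ((\<lambda>p. right_mult p u) ` {p \<in> polynomials. p [] = 0})"
    if "y \<in> (\<lambda>p. right_mult p u) ` polynomials" for y
    using that assms(2,3)
    by (auto simp: right_mult_right_mult polynomials_fock_mult right_mult_in_cyclic_tail
        simp flip: cyclic_tail_def)
qed

lemma cyclic_tail_coef_Nil:
  assumes "x \<in> cyclic_tail u"
  shows "coef x [] = 0"
proof -
  have "coef x [] \<in> closure {0}"
    using assms unfolding cyclic_tail_def
    by (rule bounded_linear_image_closure[OF bounded_linear_coef]) auto
  then show ?thesis by simp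
qed

text \<open>
  Stripping the last letter turns \<open>u \<otimes> p\<close> into \<open>u \<otimes> strip i p\<close>, provided that \<open>p\<close> has no constant
  term; otherwise a multiple of the strip of \<open>u\<close> would remain, which need not be in \<open>cyclic u\<close>.
\<close>

lemma cyclic_tail_strip:
  assumes "x \<in> cyclic_tail u"
  shows "strip_l2 i x \<in> cyclic u"
  using assms unfolding cyclic_tail_def cyclic_def
proof (rule bounded_linear_image_closure[OF bounded_linear_strip_l2])
  fix y assume "y \<in> (\<lambda>p. right_mult p u) ` {p \<in> polynomials. p [] = 0}"
  then obtain p where p: "p \<in> polynomials" "p [] = 0" "y = right_mult p u" by blast
  have "strip_l2 i y = right_mult (strip i p) u"
    unfolding p(3) strip_l2_right_mult[OF p(1)] by (rule l2_eqI) (simp add: p)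
  then show "strip_l2 i y \<in> closure ((\<lambda>p. right_mult p u) ` polynomials)"
    using right_mult_in_cyclic[OF strip_polynomials[OF p(1)]] by (simp flip: cyclic_def)
qed

text \<open>
  Modulo \<open>cyclic_tail u\<close>, each product \<open>u \<otimes> p\<close> is the multiple \<open>p [] d\<close>.  Hence a sequence of such
  products converging to \<open>x\<close> has the form \<open>c\<^sub>k d + n\<^sub>k\<close>.  As \<open>x\<close> and \<open>n\<^sub>k\<close> are
  orthogonal to all complex multiples of \<open>d\<close>, dropping the first summand only decreases the distance
  to \<open>x\<close>, so \<open>n\<^sub>k\<close> converges to \<open>x\<close> as well.
\<close>

lemma cyclic_decompose:
  assumes "x \<in> cyclic u" "u - d \<in> cyclic_tail u" "\<And>n. n \<in> cyclic_tail u \<Longrightarrow> d \<bullet> n = 0"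
    and orth: "\<And>c. x \<bullet> scaleC_l2 c d = 0"
  shows "x \<in> cyclic_tail u"
proof -
  have "\<exists>y\<in>cyclic_tail u. dist y x < e" if "e > 0" for e
  proof -
    obtain p where p: "p \<in> polynomials" "dist (right_mult p u) x < e"
      using assms(1) \<open>e > 0\<close> unfolding cyclic_def closure_approachable by blast
    define p' where "p' = (\<lambda>w. p w + (- p []) * word_vec [] w)"
    have p': "p' \<in> polynomials" "p' [] = 0"
      unfolding p'_def by (intro polynomials_add polynomials_cmult p polynomials_word_vec)
        (simp add: word_vec_def)
    \<comment> \<open>This is \<open>u \<otimes> p\<close> minus the \<open>p []\<close>-fold of \<open>d\<close>.\<close>
    define y where "y = right_mult p' u + scaleC_l2 (p []) (u - d)"
    have y: "y \<in> cyclic_tail u"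
      unfolding y_def using assms(2) p' generator_in_cyclic
      by (intro subspace_add[OF subspace_cyclic_tail] cyclic_right_mult_tail scaleC_cyclic_tail)
    have eq: "right_mult p u - x = (y - x) + scaleC_l2 (p []) d"
      by (rule l2_eqI) (simp add: y_def p' p p'_def[symmetric],
          simp add: p'_def fock_mult_add_right fock_mult_cmult_right fock_mult_diff_right algebra_simps)
    have "(y - x) \<bullet> scaleC_l2 (p []) d = 0"
      using assms(3)[OF scaleC_cyclic_tail[OF y]] orth
      by (simp add: inner_diff_left inner_commute[of y] inner_scaleC_l2)
    then have "(norm (right_mult p u - x))\<^sup>2 = (norm (y - x))\<^sup>2 + (norm (scaleC_l2 (p []) d))\<^sup>2"
      unfolding eq power2_norm_eq_inner by (simp add: inner_simps inner_commute)
    then have "norm (y - x) \<le> norm (right_mult p u - x)"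
      by (intro power2_le_imp_le[of "norm (y - x)"]) auto
    then show ?thesis using p y by (intro bexI[of _ y]) (simp_all add: dist_norm)
  qed
  then show ?thesis using closed_approachable[OF closed_cyclic(2)] by blast
qed

text \<open>
  The remainder of the Wold decomposition vanishes: orthogonality to \<open>d\<close> puts \<open>x\<close> into
  \<open>cyclic_tail u\<close>, whence its constant term is 0 and its strips are in \<open>cyclic u\<close>.  The strips
  satisfy the same orthogonality, because stripping is adjoint to appending a letter, so the argument
  repeats along any word.
\<close>

lemma wandering_vector_generates:
  fixes u d x :: "('n::finite) list l2"
  assumes d: "u - d \<in> cyclic_tail u" "\<And>n. n \<in> cyclic_tail u \<Longrightarrow> d \<bullet> n = 0"
    and x: "x \<in> cyclic u" "\<And>p. p \<in> polynomials \<Longrightarrow> x \<bullet> right_mult p d = 0"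
  shows "x = 0"
proof (rule l2_eqI)
  have tail: "y \<in> cyclic_tail u"
    if "y \<in> cyclic u" "\<And>p. p \<in> polynomials \<Longrightarrow> y \<bullet> right_mult p d = 0" for y
  proof (rule cyclic_decompose[OF that(1) d])
    show "y \<bullet> scaleC_l2 c d = 0" for c
      using that(2)[OF polynomials_cmult[OF polynomials_word_vec], of c "[]"]
      by (simp add: right_mult_cmult polynomials_word_vec)
  qed
  fix w show "coef x w = coef 0 w"
    using x
  proof (induction w arbitrary: x rule: rev_induct)
    case Nil
    then show ?case using tail cyclic_tail_coef_Nil by auto
  next
    case (snoc i w)
    have "strip_l2 i x \<bullet> right_mult p d = 0" if p: "p \<in> polynomials" for p
    proof -
      have *: "strip_l2 j (right_mult (snoc_shift i p) d) = (if j = i then right_mult p d else 0)" for j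
        unfolding strip_l2_right_mult[OF polynomials_snoc_shift[OF p]]
        by (rule l2_eqI) (simp add: p)
      have "x \<bullet> right_mult (snoc_shift i p) d = strip_l2 i x \<bullet> right_mult p d"
        unfolding inner_l2_words[of x] *
        by (simp add: p polynomials_snoc_shift if_distrib[of "\<lambda>z. _ \<bullet> z"] cong: if_cong)
      then show ?thesis using snoc.prems(2) p by (simp add: polynomials_snoc_shift)
    qed
    moreover have "strip_l2 i x \<in> cyclic u"
      using tail[OF snoc.prems] by (rule cyclic_tail_strip)
    ultimately have "coef (strip_l2 i x) w = 0" using snoc.IH[of "strip_l2 i x"] by simp
    then show ?case by (simp add: strip_def)
  qed
qed

text \<open>
  Induction on the degree.  The constant term of \<open>p\<close> contributes a multiple of \<open>d\<close>, the remaining part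
  a vector of \<open>cyclic_tail u\<close>; these are orthogonal, and the strips of the second are products of \<open>d\<close>
  with the strips of \<open>p\<close>.
\<close>

lemma norm_right_mult_wandering:
  fixes u d q :: "('n::finite) list l2"
  assumes d: "d \<in> cyclic u" "\<And>n. n \<in> cyclic_tail u \<Longrightarrow> d \<bullet> n = 0"
    and "coef q \<in> polynomials"
  shows "norm (right_mult (coef q) d) = norm d * norm q"
proof -
  have "(norm (right_mult p d))\<^sup>2 = (norm d * norm q)\<^sup>2" if "p \<in> polynomials" "coef q = p" for p q
    using that
  proof (induction p arbitrary: q rule: polynomials_induct)
    case zero
    then have "q = 0" by (intro l2_eqI) simp
    moreover have "right_mult (\<lambda>_. 0) d = 0" by (rule l2_eqI) simp
    ultimately show ?case by simp
  next
    case (step p)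
    define p' where "p' = (\<lambda>w. p w + (- p []) * word_vec [] w)"
    have p': "p' \<in> polynomials" "p' [] = 0" "strip i p' = strip i p" for i
      unfolding p'_def by (intro polynomials_add polynomials_cmult step polynomials_word_vec)
        (simp_all add: word_vec_def strip_def)
    have split: "right_mult p d = scaleC_l2 (p []) d + right_mult p' d"
      by (rule l2_eqI)
         (simp add: p' step, simp add: p'_def fock_mult_diff_right fock_mult_cmult_right)
    have "scaleC_l2 (p []) d \<bullet> right_mult p' d = 0"
      unfolding inner_scaleC_l2 using d p' by (intro d(2) scaleC_cyclic_tail cyclic_right_mult_tail)
    then have "(norm (right_mult p d))\<^sup>2 = (norm (scaleC_l2 (p []) d))\<^sup>2 + (norm (right_mult p' d))\<^sup>2"
      unfolding split power2_norm_eq_inner by (simp add: inner_simps inner_commute)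
    also have "(norm (right_mult p' d))\<^sup>2 = (\<Sum>i\<in>UNIV. (norm (right_mult (strip i p) d))\<^sup>2)"
    proof -
      have "strip_l2 i (right_mult p' d) = right_mult (strip i p) d" for i
        unfolding strip_l2_right_mult[OF p'(1)] by (rule l2_eqI) (simp add: p')
      then show ?thesis unfolding norm_l2_words[of "right_mult p' d"] by (simp add: p')
    qed
    also have "\<dots> = (\<Sum>i\<in>UNIV. (norm d * norm (strip_l2 i q))\<^sup>2)"
      using step by (intro sum.cong refl) simp
    also have "(norm (scaleC_l2 (p []) d))\<^sup>2 + \<dots> = (norm d * norm q)\<^sup>2"
      by (simp add: norm_l2_words[of q] power_mult_distrib step sum_distrib_left algebra_simps)
    finally show ?case .
  qed
  from this[OF assms(3) refl] show ?thesis by simp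
qed

section \<open>Inner and outer series as operators\<close>

text \<open>
  The component of a vector orthogonal to all polynomials has inner product 0 with every multiple of
  a basis vector, hence all its coefficients vanish.
\<close>

lemma closure_polynomials: "closure {q. coef q \<in> polynomials} = (UNIV :: ('n::finite) list l2 set)"
proof -
  let ?P = "{q :: 'n list l2. coef q \<in> polynomials}"
  have "subspace ?P"
    by (rule subspaceI) (simp_all add: polynomials_add polynomials_cmult)
  then have sub: "subspace (closure ?P)" by (rule subspace_closure)
  have "x \<in> closure ?P" for x
  proof -
    obtain y where y: "y \<in> closure ?P" "\<And>z. z \<in> closure ?P \<Longrightarrow> (x - y) \<bullet> z = 0"
      using orthogonal_projection_exists[OF sub closed_closure] by blast
    have "coef (x - y) a = 0" for a
    proof -
      define c where "c = coef (x - y) a"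
      have "(\<lambda>w. c * word_vec a w) \<in> fock"
        by (intro polynomials_in_fock polynomials_cmult polynomials_word_vec)
      then obtain z where z: "coef z = (\<lambda>w. c * word_vec a w)" by (rule fock_obtain_coef)
      have "z \<in> ?P" by (simp add: z polynomials_cmult)
      then have "(x - y) \<bullet> z = 0" by (intro y(2) subsetD[OF closure_subset])
      moreover have "(x - y) \<bullet> z = (\<Sum>\<^sub>\<infinity>w. if w = a then c \<bullet> c else 0)"
        unfolding inner_l2_def z by (rule infsum_cong) (simp add: word_vec_def c_def)
      moreover have "\<dots> = (\<Sum>\<^sub>\<infinity>w\<in>{a}. c \<bullet> c)" by (rule infsum_cong_neutral) auto
      ultimately have "c \<bullet> c = 0" by simp
      then show ?thesis by (simp add: c_def)
    qed
    then have "x = y" by (intro l2_eqI) simp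
    then show ?thesis using y by simp
  qed
  then show ?thesis by blast
qed

text \<open>
  Isometry on polynomials suffices.  A coefficient of \<open>v \<otimes> h\<close> at a word of length less than \<open>k\<close> involves only
  the truncation of \<open>h\<close> to such words, which is a polynomial; so the partial sums of squares for
  \<open>v \<otimes> h\<close> are bounded and left multiplication by \<open>v\<close> is a contraction.  By continuity it preserves
  the norm on the closure of the polynomials, which is everything.
\<close>

lemma inner_seriesI:
  fixes v :: "('n::finite) list l2"
  assumes iso: "\<And>q. coef q \<in> polynomials \<Longrightarrow> norm (right_mult (coef q) v) = norm q"
  shows "inner_series (coef v)"
proof -
  have ex: "\<exists>y. coef y = coef v \<otimes>\<^sub>F coef h \<and> norm y \<le> norm h" for h
  proof -
    have "(\<Sum>w\<in>F. (cmod ((coef v \<otimes>\<^sub>F coef h) w))\<^sup>2) \<le> (norm h)\<^sup>2" if "finite F" for F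
    proof -
      obtain k where k: "\<And>w. w \<in> F \<Longrightarrow> length w < k"
        using finite_imageI[OF \<open>finite F\<close>, of length] unfolding finite_nat_set_iff_bounded by auto
      \<comment> \<open>The words in \<open>F\<close> do not see the coefficients of \<open>h\<close> at words of length \<open>k\<close> or more.\<close>
      define p where "p = (\<lambda>w. if length w < k then coef h w else 0)"
      have p: "p \<in> polynomials"
        unfolding p_def polynomials_iff_bounded_length by (auto split: if_splits)
      obtain q where q: "coef q = p" using polynomials_in_fock[OF p] by (rule fock_obtain_coef)
      have "(\<Sum>w\<in>F. (cmod ((coef v \<otimes>\<^sub>F coef h) w))\<^sup>2) = (\<Sum>w\<in>F. (cmod (coef (right_mult p v) w))\<^sup>2)"
      proof (rule sum.cong[OF refl])
        fix w assume "w \<in> F"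
        then have "(coef v \<otimes>\<^sub>F coef h) w = (coef v \<otimes>\<^sub>F p) w"
          using k by (intro fock_mult_cong_length) (auto simp: p_def dest!: k)
        then show "(cmod ((coef v \<otimes>\<^sub>F coef h) w))\<^sup>2 = (cmod (coef (right_mult p v) w))\<^sup>2"
          by (simp add: p)
      qed
      also have "\<dots> \<le> (norm (right_mult p v))\<^sup>2" using \<open>finite F\<close> by (rule sum_coef_le_norm)
      also have "norm (right_mult p v) = norm q" using iso[of q] p q by simp
      also have "(norm q)\<^sup>2 \<le> (norm h)\<^sup>2"
        by (intro power_mono norm_l2_mono) (simp_all add: q p_def)
      finally show ?thesis .
    qed
    then show ?thesis by (rule l2_of_bounded_sums) auto
  qed
  define V where "V h = Abs_l2 (coef v \<otimes>\<^sub>F coef h)" for h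
  have V: "coef (V h) = coef v \<otimes>\<^sub>F coef h" "norm (V h) \<le> norm h" for h
    using ex[of h] unfolding V_def by (metis coef_inverse)+
  have "bounded_linear V"
  proof (rule bounded_linear_intro)
    show "norm (V h) \<le> norm h * 1" for h using V(2) by simp
  qed (auto intro!: l2_eqI simp: V fock_mult_add_right fock_mult_cmult_right)
  then have "closed {h. norm (V h) = norm h}"
    by (intro closed_Collect_eq continuous_on_norm linear_continuous_on continuous_on_id)
  moreover have "{q. coef q \<in> polynomials} \<subseteq> {h. norm (V h) = norm h}"
    using iso unfolding right_mult_def V_def by auto
  ultimately have V_iso: "norm (V h) = norm h" for h
    using closure_minimal[of "{q. coef q \<in> polynomials}" "{h. norm (V h) = norm h}"]
      closure_polynomials by blast
  have mult: "coef v \<otimes>\<^sub>F h \<in> fock \<and> norm2 (coef v \<otimes>\<^sub>F h) = norm2 h" if "h \<in> fock" for h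
  proof -
    obtain h' where h': "coef h' = h" using \<open>h \<in> fock\<close> by (rule fock_obtain_coef)
    have "coef v \<otimes>\<^sub>F h = coef (V h')" by (simp add: V h')
    then show ?thesis by (simp add: norm2_coef V_iso flip: h')
  qed
  have "norm_infty (coef v) \<le> 1"
    unfolding norm_infty_def
  proof (rule SUP_least)
    fix p :: "'n series" assume "p \<in> {p \<in> polynomials. norm2 p \<le> 1}"
    then have "norm2 (coef v \<otimes>\<^sub>F p) \<le> 1" using mult[OF polynomials_in_fock, of p] by simp
    then show "ennreal (norm2 (coef v \<otimes>\<^sub>F p)) \<le> 1" using ennreal_leI by fastforce
  qed
  then have "coef v \<in> F_infty"
    unfolding F_infty_def by (simp add: order_le_less_trans[of _ 1])
  with mult show ?thesis unfolding inner_series_def by blast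
qed

text \<open>
  Used for inner \<open>\<phi>\<close>, for which every product is square summable again.
\<close>

definition left_mult :: "('n::finite) series \<Rightarrow> 'n list l2 \<Rightarrow> 'n list l2"
  where "left_mult \<phi> h = Abs_l2 (\<phi> \<otimes>\<^sub>F coef h)"

lemma left_mult_inner_series:
  fixes \<phi> :: "('n::finite) series"
  assumes "inner_series \<phi>"
  shows coef_left_mult: "coef (left_mult \<phi> h) = \<phi> \<otimes>\<^sub>F coef h"
    and norm_left_mult: "norm (left_mult \<phi> h) = norm h"
    and bounded_linear_left_mult: "bounded_linear (left_mult \<phi>)"
proof -
  have coef: "coef (left_mult \<phi> h) = \<phi> \<otimes>\<^sub>F coef h" for h
  proof -
    have "\<phi> \<otimes>\<^sub>F coef h \<in> range coef"
      using assms unfolding inner_series_def fock_eq_range_coef[symmetric] by simp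
    then show ?thesis unfolding left_mult_def by (metis coef_inverse imageE)
  qed
  then show "coef (left_mult \<phi> h) = \<phi> \<otimes>\<^sub>F coef h" .
  have norm: "norm (left_mult \<phi> h) = norm h" for h
    using assms unfolding inner_series_def norm2_coef[symmetric] coef by simp
  then show "norm (left_mult \<phi> h) = norm h" .
  show "bounded_linear (left_mult \<phi>)"
  proof (rule bounded_linear_intro)
    show "norm (left_mult \<phi> h) \<le> norm h * 1" for h using norm by simp
  qed (auto intro!: l2_eqI simp: coef fock_mult_add_right fock_mult_cmult_right)
qed

lemma closed_range_left_mult:
  assumes "inner_series \<phi>"
  shows "closed (range (left_mult \<phi>))"
proof -
  have "complete (range (left_mult \<phi>))"
    by (rule complete_isometric_image[of 1])
       (simp_all add: left_mult_inner_series[OF assms] complete_UNIV)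
  then show ?thesis by (rule complete_imp_closed)
qed

lemma subspace_range_left_mult:
  assumes "inner_series \<phi>"
  shows "subspace (range (left_mult \<phi>))"
  by (rule linear_subspace_image[OF bounded_linear.linear[OF bounded_linear_left_mult[OF assms]]]) simp

lemma left_mult_polynomial:
  assumes "inner_series (coef v)" "coef q \<in> polynomials"
  shows "left_mult (coef v) q = right_mult (coef q) v"
  by (rule l2_eqI) (simp add: assms coef_left_mult)

lemma left_mult_right_mult:
  assumes "inner_series \<phi>" "p \<in> polynomials"
  shows "left_mult \<phi> (right_mult p g) = right_mult p (left_mult \<phi> g)"
  by (rule l2_eqI) (simp add: assms coef_left_mult fock_mult_assoc)

lemma outer_series_iff_cyclic: "outer_series (coef g) \<longleftrightarrow> cyclic g = UNIV"
proof -
  have eq: "{coef g \<otimes>\<^sub>F p | p. p \<in> polynomials} = coef ` (\<lambda>p. right_mult p g) ` polynomials"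
    by (auto simp: image_image)
  have "cyclic g = UNIV \<longleftrightarrow>
      (\<forall>h. \<forall>e>0. \<exists>s \<in> (\<lambda>p. right_mult p g) ` polynomials. dist s h < e)"
    unfolding cyclic_def by (auto simp: closure_approachable set_eq_iff)
  also have "\<dots> \<longleftrightarrow> dense_in_fock (coef ` (\<lambda>p. right_mult p g) ` polynomials)"
  proof -
    have "norm2 (\<lambda>w. coef h w - (coef g \<otimes>\<^sub>F p) w) = dist (right_mult p g) h"
      if "p \<in> polynomials" for p h
      using that by (subst dist_commute) (simp add: dist_norm norm2_coef[symmetric])
    then show ?thesis
      unfolding dense_in_fock_def fock_eq_range_coef by (simp add: image_subset_iff)
  qed
  finally show ?thesis unfolding outer_series_def eq by simp
qed

lemma inj_left_mult:
  assumes "inner_series \<phi>"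
  shows "inj (left_mult \<phi>)"
proof (rule injI)
  fix a b assume "left_mult \<phi> a = left_mult \<phi> b"
  then have "left_mult \<phi> (a - b) = 0"
    by (simp add: linear_diff bounded_linear.linear bounded_linear_left_mult[OF assms])
  then have "norm (a - b) = 0" using norm_left_mult[OF assms, of "a - b"] by simp
  then show "a = b" by simp
qed

text \<open>
  An isometry maps closed subspaces to closed subspaces, so it commutes with closures.
\<close>

lemma cyclic_left_mult:
  assumes "inner_series \<phi>"
  shows "cyclic (left_mult \<phi> g) = left_mult \<phi> ` cyclic g"
proof -
  let ?S = "(\<lambda>p. right_mult p g) ` polynomials"
  have image: "(\<lambda>p. right_mult p (left_mult \<phi> g)) ` polynomials = left_mult \<phi> ` ?S"
    by (simp add: image_image left_mult_right_mult[OF assms])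
  have "complete (left_mult \<phi> ` cyclic g)"
    by (rule complete_isometric_image[of 1])
       (simp_all add: subspace_cyclic bounded_linear_left_mult[OF assms] norm_left_mult[OF assms]
          closed_cyclic complete_eq_closed)
  then have "closed (left_mult \<phi> ` cyclic g)" by (rule complete_imp_closed)
  then have "closure (left_mult \<phi> ` ?S) \<subseteq> left_mult \<phi> ` cyclic g"
    by (rule closure_minimal[rotated]) (unfold cyclic_def, intro image_mono closure_subset)
  moreover have "left_mult \<phi> ` cyclic g \<subseteq> closure (left_mult \<phi> ` ?S)"
    unfolding cyclic_def
    by (rule closure_bounded_linear_image_subset[OF bounded_linear_left_mult[OF assms]])
  ultimately show ?thesis unfolding cyclic_def[of "left_mult \<phi> g"] image by blast
qed

section \<open>Existence of the factorization\<close>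

text \<open>
  The inner factor is the normalized wandering vector \<open>d\<close>.  The component of \<open>u\<close> orthogonal to the
  range of left multiplication by this factor lies in \<open>cyclic u\<close> and is orthogonal to all \<open>d \<otimes> p\<close>,
  hence vanishes.
\<close>

theorem inner_outer_factorization_exists:
  fixes u :: "('n::finite) list l2"
  assumes "u \<noteq> 0"
  obtains v g where "inner_series (coef v)" "cyclic g = UNIV" "u = left_mult (coef v) g"
proof -
  obtain n where n: "n \<in> cyclic_tail u" "\<And>z. z \<in> cyclic_tail u \<Longrightarrow> (u - n) \<bullet> z = 0"
    using orthogonal_projection_exists[OF subspace_cyclic_tail closed_cyclic(2)] by blast
  define d where "d = u - n"
  have d: "u - d \<in> cyclic_tail u" "\<And>z. z \<in> cyclic_tail u \<Longrightarrow> d \<bullet> z = 0"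
    using n by (simp_all add: d_def)
  have d_cyclic: "d \<in> cyclic u"
    unfolding d_def using n(1) cyclic_tail_subset
    by (intro subspace_diff[OF subspace_cyclic] generator_in_cyclic) blast
  \<comment> \<open>If \<open>d\<close> were 0, then \<open>u\<close> itself would be orthogonal to all \<open>d \<otimes> p\<close>.\<close>
  have "d \<noteq> 0"
  proof
    assume "d = 0"
    have orth: "u \<bullet> right_mult p d = 0" if "p \<in> polynomials" for p
      unfolding \<open>d = 0\<close>
      using linear_0[OF bounded_linear.linear[OF bounded_linear_right_mult[OF that]]] by simp
    have "u = 0"
      by (rule wandering_vector_generates[of u d u]) (simp_all add: d generator_in_cyclic orth)
    with assms show False by blast
  qed
  define v where "v = inverse (norm d) *\<^sub>R d"
  have v: "v \<in> cyclic u" "\<And>z. z \<in> cyclic_tail u \<Longrightarrow> v \<bullet> z = 0" "norm v = 1" "d = norm d *\<^sub>R v"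
    unfolding v_def using d_cyclic d \<open>d \<noteq> 0\<close> by (simp_all add: subspace_scale[OF subspace_cyclic])
  have inner: "inner_series (coef v)"
    by (rule inner_seriesI) (simp add: norm_right_mult_wandering[OF v(1,2)] v(3))
  define L where "L = left_mult (coef v)"
  have L_cyclic: "L h \<in> cyclic u" for h
    unfolding cyclic_def
  proof (rule bounded_linear_image_closure[where f = L])
    show "bounded_linear L" unfolding L_def by (rule bounded_linear_left_mult[OF inner])
    show "h \<in> closure {q. coef q \<in> polynomials}" unfolding closure_polynomials by blast
    show "L q \<in> closure ((\<lambda>p. right_mult p u) ` polynomials)" if "q \<in> {q. coef q \<in> polynomials}" for q
      using that cyclic_right_mult[OF v(1)]
      by (simp add: L_def left_mult_polynomial[OF inner] flip: cyclic_def)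
  qed
  have "subspace (range L)" "closed (range L)"
    unfolding L_def by (rule subspace_range_left_mult[OF inner], rule closed_range_left_mult[OF inner])
  then obtain y where y: "y \<in> range L" "\<And>z. z \<in> range L \<Longrightarrow> (u - y) \<bullet> z = 0"
    using orthogonal_projection_exists by blast
  have "u - y = 0"
  proof (rule wandering_vector_generates[OF d])
    show "u - y \<in> cyclic u"
      using y(1) L_cyclic by (intro subspace_diff[OF subspace_cyclic] generator_in_cyclic) blast
    fix p :: "'n series" assume p: "p \<in> polynomials"
    obtain q where q: "coef q = p" using polynomials_in_fock[OF p] by (rule fock_obtain_coef)
    have "right_mult p v = L q" using left_mult_polynomial[OF inner, of q] p by (simp add: q L_def)
    then have "(u - y) \<bullet> right_mult p v = 0" using y(2) by blast
    moreover have "right_mult p d = norm d *\<^sub>R right_mult p v"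
      by (subst v(4)) (rule linear_scale[OF bounded_linear.linear[OF bounded_linear_right_mult[OF p]]])
    ultimately show "(u - y) \<bullet> right_mult p d = 0" by simp
  qed
  with y(1) obtain g where g: "u = L g" by auto
  \<comment> \<open>The whole range of \<open>L\<close> is contained in \<open>cyclic u = L ` cyclic g\<close>, so injectivity makes \<open>g\<close> outer.\<close>
  have "L h \<in> L ` cyclic g" for h
    using L_cyclic cyclic_left_mult[OF inner, of g] by (simp add: g flip: L_def)
  then have "cyclic g = UNIV"
    using inj_left_mult[OF inner] by (auto simp: inj_image_mem_iff simp flip: L_def)
  with inner g show thesis by (intro that[of v g]) (simp_all add: L_def)
qed

section \<open>Uniqueness of the factorization\<close>

text \<open>
  Each factor is the other one times a series of norm 1, say \<open>\<phi>\<^sub>1 = \<phi>\<^sub>2 \<otimes> h\<close> and \<open>\<phi>\<^sub>2 = \<phi>\<^sub>1 \<otimes> k\<close>.  At a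
  shortest word in the support of either factor only the constant terms of \<open>h\<close> and \<open>k\<close> enter, and
  they turn out to be inverse to each other.  Neither exceeds 1 in modulus, so the constant term of
  \<open>h\<close> already exhausts its norm.
\<close>

lemma inner_series_unique_from_range:
  fixes \<phi>\<^sub>1 \<phi>\<^sub>2 :: "('n::finite) series"
  assumes inner: "inner_series \<phi>\<^sub>1" "inner_series \<phi>\<^sub>2"
    and range: "range (left_mult \<phi>\<^sub>1) = range (left_mult \<phi>\<^sub>2)"
  obtains \<alpha> where "cmod \<alpha> = 1" "\<phi>\<^sub>1 = (\<lambda>w. \<alpha> * \<phi>\<^sub>2 w)"
proof -
  \<comment> \<open>The unit of the product: left multiplication by \<open>\<phi>\<close> maps it to \<open>\<phi>\<close>.\<close>
  obtain e :: "'n list l2" where e: "coef e = word_vec []"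
    using polynomials_in_fock[OF polynomials_word_vec] by (rule fock_obtain_coef)
  have "strip_l2 i e = 0" for i by (rule l2_eqI) (simp add: e strip_def word_vec_def)
  then have "(norm e)\<^sup>2 = 1" by (simp add: norm_l2_words e, simp add: word_vec_def)
  then have "norm e = 1" using norm_ge_zero[of e] by (simp add: power2_eq_1_iff)
  have e_mult: "coef (left_mult \<phi> e) = \<phi>" if "inner_series \<phi>" for \<phi>
    by (simp add: coef_left_mult[OF that] e)
  obtain h where h: "left_mult \<phi>\<^sub>1 e = left_mult \<phi>\<^sub>2 h" using range by blast
  obtain k where k: "left_mult \<phi>\<^sub>2 e = left_mult \<phi>\<^sub>1 k" using range by blast
  have h_mult: "\<phi>\<^sub>1 = \<phi>\<^sub>2 \<otimes>\<^sub>F coef h" and k_mult: "\<phi>\<^sub>2 = \<phi>\<^sub>1 \<otimes>\<^sub>F coef k"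
    using arg_cong[OF h, of coef] arg_cong[OF k, of coef] e_mult inner
    by (simp_all add: coef_left_mult)
  have norm: "norm h = 1" "norm k = 1"
    using arg_cong[OF h, of norm] arg_cong[OF k, of norm] \<open>norm e = 1\<close> inner
    by (simp_all add: norm_left_mult)
  have "\<exists>w. \<phi>\<^sub>1 w \<noteq> 0 \<or> \<phi>\<^sub>2 w \<noteq> 0"
  proof (rule ccontr)
    assume "\<not> ?thesis"
    then have "left_mult \<phi>\<^sub>1 e = 0" by (intro l2_eqI) (simp add: e_mult inner)
    then show False using norm_left_mult[OF inner(1), of e] \<open>norm e = 1\<close> by simp
  qed
  then obtain w where w: "\<phi>\<^sub>1 w \<noteq> 0 \<or> \<phi>\<^sub>2 w \<noteq> 0"
    and least: "\<And>v. \<phi>\<^sub>1 v \<noteq> 0 \<or> \<phi>\<^sub>2 v \<noteq> 0 \<Longrightarrow> length w \<le> length v"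
    using ex_has_least_nat[of "\<lambda>w. \<phi>\<^sub>1 w \<noteq> 0 \<or> \<phi>\<^sub>2 w \<noteq> 0" _ length] by blast
  have zero: "\<phi>\<^sub>1 v = 0" "\<phi>\<^sub>2 v = 0" if "length v < length w" for v
    using least[of v] that by auto
  have "\<phi>\<^sub>1 w = \<phi>\<^sub>2 w * coef h []"
    by (subst h_mult) (rule fock_mult_lowest_coef, rule zero)
  moreover have "\<phi>\<^sub>2 w = \<phi>\<^sub>1 w * coef k []"
    by (subst k_mult) (rule fock_mult_lowest_coef, rule zero)
  ultimately have "\<phi>\<^sub>1 w * (coef k [] * coef h []) = \<phi>\<^sub>1 w" "\<phi>\<^sub>1 w \<noteq> 0" using w by auto
  then have "coef k [] * coef h [] = 1" by simp
  then have prod: "cmod (coef k []) * cmod (coef h []) = 1" by (metis norm_mult norm_one)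
  have "cmod (coef k []) * cmod (coef h []) \<le> 1 * cmod (coef h [])"
    using cmod_coef_le_norm[of k "[]"] norm by (intro mult_right_mono) auto
  then have h1: "cmod (coef h []) = 1" using prod cmod_coef_le_norm[of h "[]"] norm by simp
  have "(\<Sum>i\<in>UNIV. (norm (strip_l2 i h))\<^sup>2) = 0"
    using norm_l2_words[of h] norm h1 by simp
  then have "strip_l2 i h = 0" for i by (simp add: sum_nonneg_eq_0_iff)
  then have strip: "strip i (coef h) = (\<lambda>_. 0)" for i
    by (metis strip_l2.rep_eq zero_l2.rep_eq)
  have "coef h = (\<lambda>w. coef h [] * word_vec [] w)"
    by (rule series_eqI) (simp_all add: strip, simp_all add: strip_def word_vec_def)
  then have "\<phi>\<^sub>1 = (\<lambda>w. coef h [] * \<phi>\<^sub>2 w)"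
    using h_mult fock_mult_cmult_right[of \<phi>\<^sub>2 "coef h []" "word_vec []"] by simp
  with h1 show thesis by (rule that)
qed

lemma norm_infty_fock_mult_inner:
  assumes "inner_series \<phi>" "g \<in> fock"
  shows "norm_infty (\<phi> \<otimes>\<^sub>F g) = norm_infty g"
proof -
  obtain u where u: "coef u = g" using assms(2) by (rule fock_obtain_coef)
  have "norm2 (\<phi> \<otimes>\<^sub>F g \<otimes>\<^sub>F p) = norm2 (g \<otimes>\<^sub>F p)" if "p \<in> polynomials" for p
  proof -
    have "g \<otimes>\<^sub>F p \<in> fock" using coef_right_mult[OF that, of u] u by (metis coef_in_fock)
    then show ?thesis using assms(1) by (simp add: fock_mult_assoc inner_series_def)
  qed
  then show ?thesis unfolding norm_infty_def by (intro SUP_cong) auto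
qed

theorem theorem2p1:
  fixes \<psi> :: "('n::finite) series"
  assumes "\<psi> \<in> fock" and "\<psi> \<noteq> (\<lambda>_. 0)"
  shows "(\<exists>\<phi> g. inner_series \<phi> \<and> outer_series g \<and> \<psi> = \<phi> \<otimes>\<^sub>F g) \<and>
    (\<forall>\<phi>\<^sub>1 g\<^sub>1 \<phi>\<^sub>2 g\<^sub>2. inner_series \<phi>\<^sub>1 \<and> outer_series g\<^sub>1 \<and> \<psi> = \<phi>\<^sub>1 \<otimes>\<^sub>F g\<^sub>1 \<and>
        inner_series \<phi>\<^sub>2 \<and> outer_series g\<^sub>2 \<and> \<psi> = \<phi>\<^sub>2 \<otimes>\<^sub>F g\<^sub>2 \<longrightarrow>
      (\<exists>\<alpha>::complex. cmod \<alpha> = 1 \<and> \<phi>\<^sub>1 = (\<lambda>w. \<alpha> * \<phi>\<^sub>2 w) \<and> g\<^sub>2 = (\<lambda>w. \<alpha> * g\<^sub>1 w))) \<and>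
    (\<forall>\<phi> g. inner_series \<phi> \<and> outer_series g \<and> \<psi> = \<phi> \<otimes>\<^sub>F g \<longrightarrow>
      (\<psi> \<in> F_infty \<longleftrightarrow> g \<in> F_infty) \<and>
      (\<psi> \<in> F_infty \<longrightarrow> norm_infty \<psi> = norm_infty g))"
proof (intro conjI allI impI)
  obtain u where u: "coef u = \<psi>" using assms(1) by (rule fock_obtain_coef)
  with assms(2) have "u \<noteq> 0" by auto
  then obtain v g where vg: "inner_series (coef v)" "cyclic g = UNIV" "u = left_mult (coef v) g"
    by (rule inner_outer_factorization_exists)
  then have "\<psi> = coef v \<otimes>\<^sub>F coef g" using u by (simp add: coef_left_mult)
  with vg show "\<exists>\<phi> g. inner_series \<phi> \<and> outer_series g \<and> \<psi> = \<phi> \<otimes>\<^sub>F g"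
    using outer_series_iff_cyclic by blast
next
  fix \<phi>\<^sub>1 g\<^sub>1 \<phi>\<^sub>2 g\<^sub>2
  assume *: "inner_series \<phi>\<^sub>1 \<and> outer_series g\<^sub>1 \<and> \<psi> = \<phi>\<^sub>1 \<otimes>\<^sub>F g\<^sub>1 \<and>
    inner_series \<phi>\<^sub>2 \<and> outer_series g\<^sub>2 \<and> \<psi> = \<phi>\<^sub>2 \<otimes>\<^sub>F g\<^sub>2"
  then have inner: "inner_series \<phi>\<^sub>1" "inner_series \<phi>\<^sub>2" and "g\<^sub>1 \<in> fock" "g\<^sub>2 \<in> fock"
    by (auto simp: outer_series_def)
  obtain h\<^sub>1 where h1: "coef h\<^sub>1 = g\<^sub>1" using \<open>g\<^sub>1 \<in> fock\<close> by (rule fock_obtain_coef)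
  obtain h\<^sub>2 where h2: "coef h\<^sub>2 = g\<^sub>2" using \<open>g\<^sub>2 \<in> fock\<close> by (rule fock_obtain_coef)
  have eq: "left_mult \<phi>\<^sub>1 h\<^sub>1 = left_mult \<phi>\<^sub>2 h\<^sub>2"
  proof (rule l2_eqI)
    have "\<phi>\<^sub>1 \<otimes>\<^sub>F g\<^sub>1 = \<phi>\<^sub>2 \<otimes>\<^sub>F g\<^sub>2" using * by metis
    then show "coef (left_mult \<phi>\<^sub>1 h\<^sub>1) w = coef (left_mult \<phi>\<^sub>2 h\<^sub>2) w" for w
      by (simp add: coef_left_mult inner h1 h2)
  qed
  \<comment> \<open>Both ranges are the cyclic subspace generated by \<open>\<psi>\<close>.\<close>
  have "cyclic h\<^sub>1 = UNIV" "cyclic h\<^sub>2 = UNIV" using * h1 h2 outer_series_iff_cyclic by blast+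
  then have "range (left_mult \<phi>\<^sub>1) = range (left_mult \<phi>\<^sub>2)"
    using cyclic_left_mult[OF inner(1), of h\<^sub>1] cyclic_left_mult[OF inner(2), of h\<^sub>2] eq by simp
  then obtain \<alpha> where \<alpha>: "cmod \<alpha> = 1" "\<phi>\<^sub>1 = (\<lambda>w. \<alpha> * \<phi>\<^sub>2 w)"
    using inner_series_unique_from_range[OF inner] by blast
  have "left_mult \<phi>\<^sub>2 h\<^sub>2 = left_mult \<phi>\<^sub>2 (scaleC_l2 \<alpha> h\<^sub>1)"
    using eq by (intro l2_eqI) (simp add: coef_left_mult inner fock_mult_cmult_right
        flip: eq, simp add: \<alpha>(2) fock_mult_cmult_left)
  then have "h\<^sub>2 = scaleC_l2 \<alpha> h\<^sub>1" using inj_left_mult[OF inner(2)] by (simp add: inj_eq)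
  then have "g\<^sub>2 = (\<lambda>w. \<alpha> * g\<^sub>1 w)" by (simp flip: h1 h2)
  with \<alpha> show "\<exists>\<alpha>. cmod \<alpha> = 1 \<and> \<phi>\<^sub>1 = (\<lambda>w. \<alpha> * \<phi>\<^sub>2 w) \<and> g\<^sub>2 = (\<lambda>w. \<alpha> * g\<^sub>1 w)" by blast
next
  fix \<phi> g assume *: "inner_series \<phi> \<and> outer_series g \<and> \<psi> = \<phi> \<otimes>\<^sub>F g"
  then have "g \<in> fock" by (simp add: outer_series_def)
  with * have eq: "norm_infty \<psi> = norm_infty g" by (simp add: norm_infty_fock_mult_inner)
  then show "norm_infty \<psi> = norm_infty g" .
  show "\<psi> \<in> F_infty \<longleftrightarrow> g \<in> F_infty" using eq \<open>g \<in> fock\<close> assms(1) by (simp add: F_infty_def)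
qed

end
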